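(* Let $N\in\mathbb{N}$, $N\ge 1$, let $r_1>r_2>\dots>r_N>0$, and let $\varepsilon_0,\varepsilon_1,\dots,\varepsilon_N$ be positive real numbers with $\varepsilon_{j-1}\neq\varepsilon_j$ for $j=1,\dots,N$. Let $\varepsilon:\mathbb{R}^3\to\mathbb{R}$ be the piecewise constant function equal to $\varepsilon_j$ on $A_j$, $j=0,1,\dots,N$, where, with $r=|x|$, $A_0=\{r>r_1\}$, $A_j=\{r_{j+1}<r\le r_j\}$ for $1\le j\le N-1$, and $A_N=\{r\le r_N\}$. Let $H=r\sum_{m=-1}^{1}a_{0,m}Y_1^m$ with constants $a_{0,m}$, and let $u$ be the solution of $$\nabla\cdot(\varepsilon\nabla u)=0\ \text{ in }\mathbb{R}^3,\qquad u-H=O(|x|^{-1})\ \text{ as }|x|\to\infty.$$ For $j=1,\dots,N$ put $$\lambda_j=\frac{2\varepsilon_{j-1}+\varepsilon_j}{\varepsilon_{j-1}-\varepsilon_j}.$$ Let $P_N$ be the $N\times N$ matrix whose diagonal entries are $(P_N)_{jj}=\lambda_j$, whose entries above the diagonal are $(P_N)_{ij}=-1$ for $i<j$, and whose entries below the diagonal are $(P_N)_{ij}=2(r_i/r_j)^3$ for $i>j$. Let $\Upsilon_N=\mathrm{diag}(r_1^3,\dots,r_N^3)$ and $e=(1,1,\dots,1)^T\in\mathbb{R}^N$. Then, outside the multi-layer structure (that is, in $A_0$), $$u-H=r^{-3}\,H\,e^T\,\Upsilon_N\,(P_N^T)^{-1}e .$$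
   Context: $Y_1^m$, $m=-1,0,1$, denote the spherical harmonics of degree $1$ on the unit sphere of $\mathbb{R}^3$, evaluated at $x/|x|$, so that $H$ is a harmonic linear function on $\mathbb{R}^3$. The equation $\nabla\cdot(\varepsilon\nabla u)=0$ is understood in the weak sense: $u$ is harmonic in the interior of each $A_j$, and both $u$ and $\varepsilon\,\partial u/\partial r$ are continuous across each interface $\{r=r_j\}$, $j=1,\dots,N$. *)

theory Defs
  imports "HOL-Analysis.Analysis" "HOL-Library.Landau_Symbols" "Jordan_Normal_Form.Matrix"
begin

text \<open>Both HOL-Analysis and Jordan_Normal_Form use \<open>$\<close>, \<open>vec\<close> and \<open>mat\<close>. The ambient space
  is \<open>real ^ 3\<close> with coordinates \<open>vec_nth x i\<close>, whereas the \<open>N \<times> N\<close> matrices, whose size is a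
  natural number variable, are those of Jordan_Normal_Form.\<close>

definition pd :: "3 \<Rightarrow> (real ^ 3 \<Rightarrow> 'a::real_normed_vector) \<Rightarrow> real ^ 3 \<Rightarrow> 'a" where
  "pd i u x = frechet_derivative u (at x) (axis i 1)"

text \<open>To be used on open sets only: \<open>u\<close> is twice continuously differentiable with vanishing
  Laplacian.\<close>

definition harmonic_on :: "(real ^ 3 \<Rightarrow> 'a::real_normed_vector) \<Rightarrow> (real ^ 3) set \<Rightarrow> bool" where
  "harmonic_on u S \<longleftrightarrow>
     u differentiable_on S \<and>
     (\<forall>i. pd i u differentiable_on S) \<and>
     (\<forall>i j. continuous_on S (pd j (pd i u))) \<and>
     (\<forall>x\<in>S. (\<Sum>i\<in>UNIV. pd i (pd i u) x) = 0)"

text \<open>The derivative \<open>\<partial>u/\<partial>r\<close>, with \<open>sgn x = x/|x|\<close>; meaningful where \<open>u\<close> is differentiable and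
  \<open>x \<noteq> 0\<close>.\<close>

definition radial_deriv :: "(real ^ 3 \<Rightarrow> 'a::real_normed_vector) \<Rightarrow> real ^ 3 \<Rightarrow> 'a" where
  "radial_deriv u x = frechet_derivative u (at x) (sgn x)"

text \<open>The set \<open>A\<^sub>j\<close>, for \<open>j \<le> N\<close> and \<open>N \<ge> 1\<close>; the radii are \<open>r 1 > \<dots> > r N\<close>.\<close>

definition layer :: "nat \<Rightarrow> (nat \<Rightarrow> real) \<Rightarrow> nat \<Rightarrow> (real ^ 3) set" where
  "layer N r j =
     (if j = 0 then {x. norm x > r 1}
      else if j < N then {x. r (j + 1) < norm x \<and> norm x \<le> r j}
      else {x. norm x \<le> r N})"

text \<open>Weak solutions of \<open>\<nabla>\<cdot>(\<sigma>\<nabla>u) = 0\<close> for a coefficient \<open>\<sigma>\<close> that is constant on each layer. As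
  \<open>\<partial>u/\<partial>r\<close> need not exist on the interface itself, continuity of \<open>\<sigma> \<partial>u/\<partial>r\<close> across it
  means that the limit at each of its points, taken over both sides at once, exists.\<close>

definition layered_solution ::
  "nat \<Rightarrow> (nat \<Rightarrow> real) \<Rightarrow> (real ^ 3 \<Rightarrow> real) \<Rightarrow> (real ^ 3 \<Rightarrow> complex) \<Rightarrow> bool" where
  "layered_solution N r \<sigma> u \<longleftrightarrow>
     (\<forall>j\<le>N. harmonic_on u (interior (layer N r j))) \<and>
     (\<forall>j\<in>{1..N}. \<forall>x. norm x = r j \<longrightarrow>
        isCont u x \<and>
        (\<exists>L. ((\<lambda>y. \<sigma> y *\<^sub>R radial_deriv u y) \<longlongrightarrow> L) (at x within {y. norm y \<noteq> r j})))"

text \<open>The complex orthonormal spherical harmonics of degree 1 with Condon-Shortley phase, in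
  Cartesian coordinates of the point \<open>x\<close> of the unit sphere. As their coefficients are arbitrary
  complex numbers, the choice of basis (real or complex) and normalisation is immaterial.\<close>

definition Y1 :: "int \<Rightarrow> real ^ 3 \<Rightarrow> complex" where
  "Y1 m x =
     (if m = 0 then complex_of_real (sqrt (3 / (4 * pi)) * vec_nth x 3)
      else if m = 1 then - complex_of_real (sqrt (3 / (8 * pi))) * Complex (vec_nth x 1) (vec_nth x 2)
      else if m = -1 then complex_of_real (sqrt (3 / (8 * pi))) * Complex (vec_nth x 1) (- vec_nth x 2)
      else 0)"

lemma Y1_spherical_coordinates:
  fixes \<theta> \<phi> :: real
  defines "x \<equiv> vector [sin \<theta> * cos \<phi>, sin \<theta> * sin \<phi>, cos \<theta>]"
  shows "Y1 0 x = complex_of_real (sqrt (3 / (4 * pi)) * cos \<theta>)"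
    and "Y1 1 x = - complex_of_real (sqrt (3 / (8 * pi)) * sin \<theta>) * cis \<phi>"
    and "Y1 (-1) x = complex_of_real (sqrt (3 / (8 * pi)) * sin \<theta>) * cis (- \<phi>)"
  by (simp_all add: Y1_def x_def vector_3 complex_eq_iff)

definition background :: "(int \<Rightarrow> complex) \<Rightarrow> real ^ 3 \<Rightarrow> complex" where
  "background a x = complex_of_real (norm x) * (\<Sum>m\<in>{-1..1}. a m * Y1 m (x /\<^sub>R norm x))"

definition lam :: "(nat \<Rightarrow> real) \<Rightarrow> nat \<Rightarrow> real" where
  "lam \<epsilon> j = (2 * \<epsilon> (j - 1) + \<epsilon> j) / (\<epsilon> (j - 1) - \<epsilon> j)"

text \<open>Matrix and vector entries are indexed from \<open>0\<close>, layers from \<open>1\<close>; hence the shifts.\<close>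

definition P_mat :: "nat \<Rightarrow> (nat \<Rightarrow> real) \<Rightarrow> (nat \<Rightarrow> real) \<Rightarrow> real mat" where
  "P_mat N r \<epsilon> = Matrix.mat N N (\<lambda>(i, j).
     if i = j then lam \<epsilon> (i + 1)
     else if i < j then -1
     else 2 * (r (i + 1) / r (j + 1)) ^ 3)"

definition Upsilon_mat :: "nat \<Rightarrow> (nat \<Rightarrow> real) \<Rightarrow> real mat" where
  "Upsilon_mat N r = mat_diag N (\<lambda>i. r (i + 1) ^ 3)"

definition ones_vec :: "nat \<Rightarrow> real Matrix.vec" where
  "ones_vec N = Matrix.vec N (\<lambda>_. 1)"

end

theory Submission
  imports Defs "Jordan_Normal_Form.Determinant"
begin

text \<open>The problem with prescribed behaviour at infinity has at most one solution
  (\<open>transmission_solution_unique\<close>), so it is enough to exhibit one and to read off its exterior part.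

  The explicit solution is \<open>H\<close> plus a superposition of fields generated by charges on the
  interfaces. The charge on the sphere of radius \<open>r\<^sub>j\<close> generates the potential that is \<open>H\<close> inside and
  \<open>r\<^sub>j\<^sup>3 H / |x|\<^sup>3\<close> outside; it is continuous, and harmonic off the sphere. With coefficients
  \<open>c\<^sub>1, \<dots>, c\<^sub>N\<close> the field is continuous and piecewise harmonic, and continuity of the flux at the
  \<open>i\<close>-th interface becomes one linear equation. Together these equations say \<open>P\<^sup>T c = e\<close>
  (\<open>layered_field_transmission_solution\<close>, \<open>transpose_P_mat_mult\<close>). Outside all layers every potential is
  a dipole, and the sum of their moments \<open>\<Sum>\<^sub>j c\<^sub>j r\<^sub>j\<^sup>3\<close> is \<open>e\<^sup>T \<Upsilon> c\<close>.

  Invertibility of \<open>P\<close> is again a consequence of uniqueness: a solution of \<open>P\<^sup>T c = 0\<close> gives a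
  decaying solution with zero background, which must vanish, and a vanishing field carries no
  charges (\<open>layered_field_zero_imp_coefficients_zero\<close>).

  Uniqueness is proved by a maximum argument rather than an energy identity, so no integration is
  needed: at a maximum point farthest from the origin a barrier of the form \<open>\<alpha> + \<beta>/|x|\<close> makes the
  outward radial derivative strictly negative, whereas the inward side cannot be decreasing
  towards the maximum. Positivity of the coefficient makes this incompatible with a continuous
  flux. The only fact on harmonic functions that enters is the weak maximum principle, which
  follows from the second derivative test.\<close>

section \<open>Functions harmonic at a point\<close>

text \<open>The derivative is a parameter \<open>F\<close> rather than \<open>frechet_derivative w (at x)\<close>: for the explicit
  functions below \<open>F\<close> is a formula, so linear combinations and the flux through a sphere can be
  computed without differentiability side conditions.\<close>

definition harmonic_at ::
  "(real ^ 3 \<Rightarrow> 'a::real_normed_vector) \<Rightarrow> (real ^ 3 \<Rightarrow> real ^ 3 \<Rightarrow> 'a) \<Rightarrow> real ^ 3 \<Rightarrow> bool" where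
  "harmonic_at w F x \<longleftrightarrow>
     (w has_derivative F x) (at x) \<and>
     (\<exists>G. (\<forall>i. ((\<lambda>y. F y (axis i 1)) has_derivative G i) (at x)) \<and> (\<Sum>i\<in>UNIV. G i (axis i 1)) = 0)"

lemma harmonic_at_cong_open:
  assumes "harmonic_at w F x" "open U" "x \<in> U"
    and "\<And>y. y \<in> U \<Longrightarrow> w y = w' y" "\<And>y. y \<in> U \<Longrightarrow> F y = F' y"
  shows "harmonic_at w' F' x"
proof -
  obtain G where w: "(w has_derivative F x) (at x)"
    and G: "\<And>i. ((\<lambda>y. F y (axis i 1)) has_derivative G i) (at x)"
    and tr: "(\<Sum>i\<in>UNIV. G i (axis i 1)) = 0"
    using assms(1) by (auto simp: harmonic_at_def)
  have "(w' has_derivative F x) (at x)"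
    by (rule has_derivative_transform_within_open[OF w assms(2,3)]) (use assms(4) in auto)
  moreover have "((\<lambda>y. F' y (axis i 1)) has_derivative G i) (at x)" for i
    by (rule has_derivative_transform_within_open[OF G assms(2,3)]) (use assms(5) in auto)
  ultimately show ?thesis
    using tr assms(3,5) by (auto simp: harmonic_at_def)
qed

lemma harmonic_at_bounded_linear:
  assumes "bounded_linear f" "harmonic_at w F x"
  shows "harmonic_at (\<lambda>y. f (w y)) (\<lambda>y v. f (F y v)) x"
proof -
  interpret f: bounded_linear f by fact
  obtain G where w: "(w has_derivative F x) (at x)"
    and G: "\<And>i. ((\<lambda>y. F y (axis i 1)) has_derivative G i) (at x)"
    and tr: "(\<Sum>i\<in>UNIV. G i (axis i 1)) = 0"
    using assms(2) by (auto simp: harmonic_at_def)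
  have "(\<Sum>i\<in>UNIV. f (G i (axis i 1))) = 0"
    using tr by (simp flip: f.sum)
  then show ?thesis
    unfolding harmonic_at_def
    by (intro conjI exI[of _ "\<lambda>i v. f (G i v)"] allI f.has_derivative w G)
qed

lemma harmonic_at_add:
  assumes "harmonic_at w F x" "harmonic_at w' F' x"
  shows "harmonic_at (\<lambda>y. w y + w' y) (\<lambda>y v. F y v + F' y v) x"
proof -
  obtain G where w: "(w has_derivative F x) (at x)"
    and G: "\<And>i. ((\<lambda>y. F y (axis i 1)) has_derivative G i) (at x)"
    and tr: "(\<Sum>i\<in>UNIV. G i (axis i 1)) = 0"
    using assms(1) by (auto simp: harmonic_at_def)
  obtain G' where w': "(w' has_derivative F' x) (at x)"
    and G': "\<And>i. ((\<lambda>y. F' y (axis i 1)) has_derivative G' i) (at x)"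
    and tr': "(\<Sum>i\<in>UNIV. G' i (axis i 1)) = 0"
    using assms(2) by (auto simp: harmonic_at_def)
  show ?thesis
    unfolding harmonic_at_def
    by (intro conjI exI[of _ "\<lambda>i v. G i v + G' i v"] allI has_derivative_add w w' G G')
       (simp add: sum.distrib tr tr')
qed

lemma harmonic_at_scaleR:
  "harmonic_at w F x \<Longrightarrow> harmonic_at (\<lambda>y. c *\<^sub>R w y) (\<lambda>y v. c *\<^sub>R F y v) x"
  by (rule harmonic_at_bounded_linear[OF bounded_linear_scaleR_right])

lemma harmonic_at_diff:
  assumes "harmonic_at w F x" "harmonic_at w' F' x"
  shows "harmonic_at (\<lambda>y. w y - w' y) (\<lambda>y v. F y v - F' y v) x"
  using harmonic_at_add[OF assms(1) harmonic_at_scaleR[OF assms(2), of "-1"]] by simp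

lemma harmonic_at_const: "harmonic_at (\<lambda>y. c) (\<lambda>y v. 0) x"
  unfolding harmonic_at_def by (auto intro!: exI[of _ "\<lambda>i v. 0"])

lemma harmonic_at_sum:
  assumes "finite A" "\<And>j. j \<in> A \<Longrightarrow> harmonic_at (w j) (F j) x"
  shows "harmonic_at (\<lambda>y. \<Sum>j\<in>A. w j y) (\<lambda>y v. \<Sum>j\<in>A. F j y v) x"
  using assms by (induction rule: finite_induct) (auto intro: harmonic_at_const harmonic_at_add)

lemma harmonic_at_linear: "bounded_linear h \<Longrightarrow> harmonic_at h (\<lambda>y v. h v) x"
  unfolding harmonic_at_def
  by (auto intro!: exI[of _ "\<lambda>i v. 0"] bounded_linear_imp_has_derivative)

lemma harmonic_on_imp_harmonic_at:
  assumes "harmonic_on u S" "open S" "x \<in> S"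
  shows "harmonic_at u (\<lambda>y. frechet_derivative u (at y)) x"
proof -
  have u: "u differentiable at x" and pd: "\<And>i. pd i u differentiable at x"
    using assms differentiable_on_eq_differentiable_at[OF assms(2)] by (auto simp: harmonic_on_def)
  show ?thesis
    unfolding harmonic_at_def
  proof (intro conjI exI[of _ "\<lambda>i. frechet_derivative (pd i u) (at x)"] allI)
    show "((\<lambda>y. frechet_derivative u (at y) (axis i 1)) has_derivative frechet_derivative (pd i u) (at x)) (at x)"
      for i using pd[of i] unfolding pd_def frechet_derivative_works .
    show "(\<Sum>i\<in>UNIV. frechet_derivative (pd i u) (at x) (axis i 1)) = 0"
      using assms(1,3) by (simp add: harmonic_on_def pd_def[of _ "pd _ u"])
  qed (use u frechet_derivative_works in blast)
qed

section \<open>The point charge and the dipole\<close>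

lemma has_derivative_inverse_norm_power:
  fixes x :: "'a::real_inner"
  assumes "x \<noteq> 0"
  shows "((\<lambda>y. inverse (norm y) ^ n) has_derivative
           (\<lambda>v. - real n * inverse (norm x) ^ (n + 2) * inner x v)) (at x)"
proof (cases n)
  case (Suc m)
  show ?thesis
    by (rule derivative_eq_intros has_derivative_norm assms refl | simp add: assms)+
       (auto simp: fun_eq_iff Suc sgn_div_norm inner_commute field_simps power2_eq_square assms)
qed simp

lemma sum_axis_sq: "(\<Sum>i\<in>UNIV. (inner x (axis i 1))\<^sup>2) = (norm (x :: real ^ 3))\<^sup>2"
  by (simp add: inner_axis norm_vec_def L2_set_def real_sqrt_pow2 sum_nonneg)

lemma sum_axis_linear:
  assumes "bounded_linear h"
  shows "(\<Sum>i\<in>UNIV. inner x (axis i 1) *\<^sub>R h (axis i 1)) = h (x :: real ^ 3)"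
proof -
  interpret h: bounded_linear h by fact
  have "(\<Sum>i\<in>UNIV. inner x (axis i 1) *\<^sub>R h (axis i 1))
      = h (\<Sum>i\<in>UNIV. inner x (axis i 1) *\<^sub>R axis i 1)"
    by (simp add: h.sum h.scaleR)
  also have "(\<Sum>i\<in>UNIV. inner x (axis i 1) *\<^sub>R axis i 1) = x"
    using basis_expansion[of x] by (simp add: inner_axis scalar_mult_eq_scaleR)
  finally show ?thesis .
qed

text \<open>The Newtonian potential of a point charge; it serves as the barrier in the uniqueness proof.\<close>

lemma harmonic_at_inverse_norm:
  assumes "x \<noteq> 0"
  shows "harmonic_at (\<lambda>y. inverse (norm y)) (\<lambda>y v. - (inverse (norm y) ^ 3) * inner y v) x"
proof -
  define G where "G i v = 3 * inverse (norm x) ^ 5 * inner x v * inner x (axis i 1)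
      - inverse (norm x) ^ 3 * inner v (axis i 1)" for i :: 3 and v
  have "((\<lambda>y. inverse (norm y)) has_derivative (\<lambda>v. - (inverse (norm x) ^ 3) * inner x v)) (at x)"
    using has_derivative_inverse_norm_power[OF assms, of 1] by (simp add: numeral_eq_Suc)
  moreover have "((\<lambda>y. - (inverse (norm y) ^ 3) * inner y (axis i 1)) has_derivative G i) (at x)" for i
    by (rule derivative_eq_intros has_derivative_inverse_norm_power assms refl)+
       (auto simp: G_def fun_eq_iff)
  moreover have "(\<Sum>i\<in>UNIV. G i (axis i 1)) = 0"
  proof -
    have "G i (axis i 1) = 3 * inverse (norm x) ^ 5 * (inner x (axis i 1))\<^sup>2 - inverse (norm x) ^ 3" for i
      by (simp add: G_def power2_eq_square inner_axis_axis)
    then have "(\<Sum>i\<in>UNIV. G i (axis i 1))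
        = 3 * inverse (norm x) ^ 5 * (norm x)\<^sup>2 - 3 * inverse (norm x) ^ 3"
      by (simp add: sum_subtractf sum_axis_sq flip: sum_distrib_left)
    also have "\<dots> = 0"
      using assms by (simp add: field_simps numeral_eq_Suc)
    finally show ?thesis .
  qed
  ultimately show ?thesis
    unfolding harmonic_at_def by blast
qed

text \<open>The Kelvin transform of a linear function. In the trace of the second derivative the terms in
  \<open>h x / |x|\<^sup>5\<close> come with the coefficients \<open>-3\<close> and \<open>-3\<close> from the two mixed products, \<open>-9\<close> from
  the dimension, and \<open>15\<close> from differentiating \<open>1 / |x|\<^sup>5\<close>; they cancel.\<close>

lemma harmonic_at_dipole:
  assumes h: "bounded_linear h" and "x \<noteq> 0"
  shows "harmonic_at (\<lambda>y. inverse (norm y) ^ 3 *\<^sub>R h y)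
     (\<lambda>y v. inverse (norm y) ^ 3 *\<^sub>R h v - (3 * inverse (norm y) ^ 5 * inner y v) *\<^sub>R h y) x"
proof -
  define p where "p n = inverse (norm x) ^ n" for n
  define e :: "3 \<Rightarrow> real ^ 3" where "e i = axis i 1" for i
  define G where "G i v = - (3 * p 5 * inner x v) *\<^sub>R h (e i)
      - (3 * p 5 * inner x (e i)) *\<^sub>R h v
      - (3 * p 5 * inner v (e i)) *\<^sub>R h x
      + (15 * p 7 * inner x v * inner x (e i)) *\<^sub>R h x" for i v
  have hd: "(h has_derivative h) (at x)"
    by (rule bounded_linear_imp_has_derivative[OF h])
  have 1: "((\<lambda>y. inverse (norm y) ^ 3 *\<^sub>R h y) has_derivative
     (\<lambda>v. inverse (norm x) ^ 3 *\<^sub>R h v - (3 * inverse (norm x) ^ 5 * inner x v) *\<^sub>R h x)) (at x)"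
    by (rule derivative_eq_intros has_derivative_inverse_norm_power assms hd refl)+
       (auto simp: fun_eq_iff)
  have 2: "((\<lambda>y. inverse (norm y) ^ 3 *\<^sub>R h (e i)
      - (3 * inverse (norm y) ^ 5 * inner y (e i)) *\<^sub>R h y) has_derivative G i) (at x)" for i
    by (rule derivative_eq_intros has_derivative_inverse_norm_power assms hd refl)+
       (auto simp: G_def p_def fun_eq_iff algebra_simps)
  have "G i (e i) = - (6 * p 5) *\<^sub>R (inner x (e i) *\<^sub>R h (e i)) - (3 * p 5) *\<^sub>R h x
      + (15 * p 7 * (inner x (e i))\<^sup>2) *\<^sub>R h x" for i
  proof -
    have "inner (e i) (e i) = 1"
      by (simp add: e_def inner_axis_axis)
    then have "G i (e i) = - (3 * p 5 * inner x (e i)) *\<^sub>R h (e i)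
      - (3 * p 5 * inner x (e i)) *\<^sub>R h (e i) - (3 * p 5) *\<^sub>R h x
      + (15 * p 7 * (inner x (e i))\<^sup>2) *\<^sub>R h x"
      by (simp add: G_def power2_eq_square mult.assoc)
    then show ?thesis
      by (simp flip: scaleR_add_left scaleR_left_distrib add: algebra_simps)
  qed
  then have "(\<Sum>i\<in>UNIV. G i (e i)) = - (6 * p 5) *\<^sub>R (\<Sum>i\<in>UNIV. inner x (e i) *\<^sub>R h (e i))
      - (\<Sum>i\<in>(UNIV :: 3 set). (3 * p 5) *\<^sub>R h x)
      + (15 * p 7 * (\<Sum>i\<in>UNIV. (inner x (e i))\<^sup>2)) *\<^sub>R h x"
    by (simp add: sum.distrib sum_subtractf sum_negf scaleR_sum_right scaleR_sum_left sum_distrib_left)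
  also have "\<dots> = - (6 * p 5) *\<^sub>R h x - 3 *\<^sub>R (3 * p 5) *\<^sub>R h x
      + (15 * p 7 * (norm x)\<^sup>2) *\<^sub>R h x"
    using sum_axis_linear[OF h, of x] sum_axis_sq[of x]
    by (simp only: e_def sum_constant_scaleR) simp
  also have "\<dots> = (15 * p 7 * (norm x)\<^sup>2 - 15 * p 5) *\<^sub>R h x"
    by (simp add: algebra_simps flip: scaleR_left_distrib)
  also have "15 * p 7 * (norm x)\<^sup>2 - 15 * p 5 = 0"
    using assms(2) by (simp add: p_def field_simps numeral_eq_Suc)
  finally have "(\<Sum>i\<in>UNIV. G i (e i)) = 0"
    by simp
  with 1 2 show ?thesis
    unfolding harmonic_at_def e_def by blast
qed

section \<open>The weak maximum principle\<close>

lemma second_derivative_nonpos_at_local_max: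
  fixes f f' :: "real \<Rightarrow> real"
  assumes "d > 0" and f: "\<And>t. \<bar>t\<bar> < d \<Longrightarrow> (f has_real_derivative f' t) (at t)"
    and f': "(f' has_real_derivative l) (at 0)"
    and max: "\<And>t. \<bar>t\<bar> < d \<Longrightarrow> f t \<le> f 0"
  shows "l \<le> 0"
proof (rule ccontr)
  assume "\<not> l \<le> 0"
  have "f' 0 = 0"
    using DERIV_local_max[OF f, of 0 d] \<open>d > 0\<close> max by simp
  obtain e where e: "e > 0" "\<And>h. 0 < h \<Longrightarrow> h < e \<Longrightarrow> f' h > 0"
    using DERIV_pos_inc_right[OF f'] \<open>\<not> l \<le> 0\<close> \<open>f' 0 = 0\<close> by auto
  define s where "s = min d e / 2"
  have s: "0 < s" "s < d" "s < e"
    using \<open>d > 0\<close> \<open>e > 0\<close> by (auto simp: s_def min_def)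
  have "\<exists>z. 0 < z \<and> z < s \<and> f s - f 0 = (s - 0) * f' z"
    by (rule MVT2) (use s f in auto)
  then obtain z where z: "0 < z" "z < s" "f s - f 0 = s * f' z"
    by auto
  then have "f s > f 0"
    using e(2)[of z] s mult_pos_pos[of s "f' z"] by linarith
  with max[of s] s show False
    by auto
qed

text \<open>An interior maximum of \<open>v\<close> does not contradict \<open>\<Delta>v = 0\<close>, but an interior maximum of
  \<open>v + \<eta>|x|\<^sup>2\<close> does contradict \<open>\<Delta>(v + \<eta>|x|\<^sup>2) = 6\<eta> > 0\<close>, because there the second derivative along
  each coordinate axis would be nonpositive.\<close>

lemma harmonic_maximum_principle:
  fixes v :: "real ^ 3 \<Rightarrow> real"
  assumes "open U" "bounded U" and cont: "continuous_on (closure U) v"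
    and harm: "\<And>x. x \<in> U \<Longrightarrow> harmonic_at v F x"
    and bd: "\<And>x. x \<in> frontier U \<Longrightarrow> v x \<le> M"
    and "x \<in> U"
  shows "v x \<le> M"
proof (rule ccontr)
  assume "\<not> v x \<le> M"
  have cpt: "compact (closure U)"
    using \<open>bounded U\<close> by (simp add: compact_closure)
  obtain B where B: "B > 0" "\<And>y. y \<in> closure U \<Longrightarrow> norm y \<le> B"
    using compact_imp_bounded[OF cpt] bounded_pos by metis
  \<comment> \<open>Adding a small multiple of \<open>|x|\<^sup>2\<close> makes the Laplacian positive while keeping the value at
     \<open>x\<close> above the boundary values.\<close>
  define \<eta> where "\<eta> = (v x - M) / (2 * B\<^sup>2)"
  have \<eta>: "\<eta> > 0" "\<eta> * B\<^sup>2 < v x - M"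
    using \<open>\<not> v x \<le> M\<close> \<open>B > 0\<close> by (auto simp: \<eta>_def)
  define z where "z y = v y + \<eta> * inner y y" for y
  have "continuous_on (closure U) z"
    unfolding z_def by (intro continuous_intros cont)
  moreover have "closure U \<noteq> {}"
    using \<open>x \<in> U\<close> by auto
  ultimately obtain y where y: "y \<in> closure U" "\<And>y'. y' \<in> closure U \<Longrightarrow> z y' \<le> z y"
    using continuous_attains_sup[OF cpt, of z] by auto
  have "z y \<ge> v x"
  proof -
    have "x \<in> closure U"
      using \<open>x \<in> U\<close> closure_subset by blast
    moreover have "v x \<le> z x"
      using \<eta>(1) by (simp add: z_def)
    ultimately show ?thesis
      using y(2) by (meson order_trans)
  qed
  have "y \<in> U"
  proof (rule ccontr)
    assume "y \<notin> U"
    then have "v y \<le> M"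
      using y(1) bd \<open>open U\<close> by (simp add: frontier_def interior_open)
    moreover have "inner y y \<le> B\<^sup>2"
      using B(2)[OF y(1)] by (simp add: power_mono flip: power2_norm_eq_inner)
    then have "\<eta> * inner y y \<le> \<eta> * B\<^sup>2"
      using \<eta>(1) by simp
    ultimately show False
      using \<open>z y \<ge> v x\<close> \<eta>(2) by (simp add: z_def)
  qed
  then obtain d where d: "d > 0" "ball y d \<subseteq> U"
    using \<open>open U\<close> open_contains_ball by blast
  obtain G where G: "\<And>i. ((\<lambda>y. F y (axis i 1)) has_derivative G i) (at y)"
    and tr: "(\<Sum>i\<in>UNIV. G i (axis i 1)) = 0"
    using harm[OF \<open>y \<in> U\<close>] by (auto simp: harmonic_at_def)
  have "G i (axis i 1) + 2 * \<eta> \<le> 0" for i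
  proof -
    define e :: "real ^ 3" where "e = axis i 1"
    have e: "norm e = 1"
      by (simp add: e_def)
    define l where "l t = y + t *\<^sub>R e" for t
    have lU: "l t \<in> U" if "\<bar>t\<bar> < d" for t
      using d(2) that e by (auto simp: l_def dist_norm)
    have dl: "(l has_derivative (\<lambda>h. h *\<^sub>R e)) (at t)" for t
      unfolding l_def by (auto intro!: derivative_eq_intros)
    show ?thesis
    proof (rule second_derivative_nonpos_at_local_max[OF d(1)])
      show "z (l t) \<le> z (l 0)" if "\<bar>t\<bar> < d" for t
        using y(2)[of "l t"] lU[OF that] closure_subset[of U] by (auto simp: l_def)
      show "((\<lambda>t. z (l t)) has_real_derivative F (l t) e + 2 * \<eta> * inner (l t) e) (at t)"
        if t: "\<bar>t\<bar> < d" for t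
      proof -
        have dv: "(v has_derivative F (l t)) (at (l t))"
          using harm[OF lU[OF t]] by (simp add: harmonic_at_def)
        have lin: "bounded_linear (F (l t))"
          by (rule has_derivative_bounded_linear[OF dv])
        have "((\<lambda>t. v (l t)) has_derivative (\<lambda>h. F (l t) (h *\<^sub>R e))) (at t)"
          by (rule has_derivative_compose[OF dl dv])
        then have 1: "((\<lambda>t. v (l t)) has_real_derivative F (l t) e) (at t)"
          by (simp add: has_field_derivative_def linear_scale[OF bounded_linear.linear[OF lin]] mult_commute_abs)
        have 2: "((\<lambda>t. inner (l t) (l t)) has_real_derivative 2 * inner (l t) e) (at t)"
          by (rule has_derivative_imp_has_field_derivative[OF has_derivative_inner[OF dl[of t] dl[of t]]])
             (simp add: inner_commute)
        show ?thesis
          using DERIV_add[OF 1 DERIV_cmult[OF 2, of \<eta>]] by (simp add: z_def mult.assoc mult.left_commute)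
      qed
      have "((\<lambda>t. F (l t) e) has_derivative (\<lambda>h. G i (h *\<^sub>R e))) (at 0)"
        by (rule has_derivative_compose[OF dl]) (use G[of i] in \<open>simp add: l_def e_def\<close>)
      then have 1: "((\<lambda>t. F (l t) e) has_real_derivative G i e) (at 0)"
        by (simp add: has_field_derivative_def mult_commute_abs
            linear_scale[OF bounded_linear.linear[OF has_derivative_bounded_linear[OF G[of i]]]])
      have 2: "((\<lambda>t. inner (l t) e) has_real_derivative 1) (at 0)"
        using has_derivative_inner_left[OF dl[of 0], of e] e
        by (simp add: has_field_derivative_def norm_eq_1 mult_commute_abs)
      show "((\<lambda>t. F (l t) e + 2 * \<eta> * inner (l t) e) has_real_derivative G i (axis i 1) + 2 * \<eta>) (at 0)"
        using DERIV_add[OF 1 DERIV_cmult[OF 2, of "2 * \<eta>"]] by (simp add: e_def)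
    qed
  qed
  then have "(\<Sum>i\<in>(UNIV :: 3 set). G i (axis i 1) + 2 * \<eta>) \<le> 0"
    by (intro sum_nonpos) auto
  then show False
    using tr \<eta>(1) by (simp add: sum.distrib)
qed

section \<open>Uniqueness for the transmission problem\<close>

text \<open>The interfaces are the spheres about the origin with radii in \<open>R\<close>. Only the limit of the flux at
  each interface point is prescribed, nothing about tangential derivatives near the interface.\<close>

definition transmission_solution ::
  "real set \<Rightarrow> (real ^ 3 \<Rightarrow> real) \<Rightarrow> (real ^ 3 \<Rightarrow> 'a::real_normed_vector)
    \<Rightarrow> (real ^ 3 \<Rightarrow> real ^ 3 \<Rightarrow> 'a) \<Rightarrow> bool" where
  "transmission_solution R \<sigma> w F \<longleftrightarrow>
     (\<forall>x. norm x \<notin> R \<longrightarrow> harmonic_at w F x) \<and>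
     (\<forall>x. norm x \<in> R \<longrightarrow> isCont w x \<and>
        (\<exists>L. ((\<lambda>y. \<sigma> y *\<^sub>R F y (sgn y)) \<longlongrightarrow> L) (at x within {y. norm y \<noteq> norm x})))"

lemma transmission_solution_bounded_linear:
  assumes "bounded_linear f" "transmission_solution R \<sigma> w F"
  shows "transmission_solution R \<sigma> (\<lambda>y. f (w y)) (\<lambda>y v. f (F y v))"
proof -
  have "\<exists>L'. ((\<lambda>y. \<sigma> y *\<^sub>R f (F y (sgn y))) \<longlongrightarrow> L') A"
    if "((\<lambda>y. \<sigma> y *\<^sub>R F y (sgn y)) \<longlongrightarrow> L) A" for L A
    using bounded_linear.tendsto[OF assms(1) that]
    by (auto simp: linear_scale[OF bounded_linear.linear[OF assms(1)]])
  then show ?thesis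
    using assms(2) unfolding transmission_solution_def
    by (blast intro: harmonic_at_bounded_linear[OF assms(1)] bounded_linear.isCont[OF assms(1)])
qed

lemma transmission_solution_diff:
  assumes "transmission_solution R \<sigma> w F" "transmission_solution R \<sigma> w' F'"
  shows "transmission_solution R \<sigma> (\<lambda>y. w y - w' y) (\<lambda>y v. F y v - F' y v)"
proof -
  have "\<exists>L. ((\<lambda>y. \<sigma> y *\<^sub>R (F y (sgn y) - F' y (sgn y))) \<longlongrightarrow> L) A"
    if "((\<lambda>y. \<sigma> y *\<^sub>R F y (sgn y)) \<longlongrightarrow> L1) A" "((\<lambda>y. \<sigma> y *\<^sub>R F' y (sgn y)) \<longlongrightarrow> L2) A" for L1 L2 A
    using tendsto_diff[OF that] by (auto simp: scaleR_diff_right)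
  then show ?thesis
    using assms unfolding transmission_solution_def
    by (blast intro: harmonic_at_diff continuous_diff)
qed

text \<open>This is a Hopf-type boundary point argument. If \<open>w\<close> had a positive value, it would attain its
  maximum \<open>M\<close>; take a maximum point \<open>x0\<close> as far from the origin as possible, on the sphere of
  radius \<open>\<rho>\<close>. Just outside that sphere \<open>w < M\<close>, so on a thin shell \<open>\<rho> < |x| < R0\<close> free of interfaces
  \<open>w\<close> lies below the barrier \<open>M - \<delta>(1/\<rho> - 1/|x|)\<close> for some \<open>\<delta> > 0\<close>: this holds on both
  boundary spheres, hence inside by the maximum principle. Therefore \<open>w\<close> decreases at a definite
  rate along the ray leaving \<open>x0\<close> outwards. If \<open>x0\<close> is not on an interface, this contradicts
  the vanishing of the gradient at a maximum. If it is, the outer flux is bounded above by a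
  negative number while the inner flux cannot have a negative limit, as \<open>w \<le> M\<close> inside; but the two limits agree.
  The strong maximum principle is avoided by the choice of the farthest maximum point.\<close>

lemma transmission_solution_nonpos:
  fixes w :: "real ^ 3 \<Rightarrow> real"
  assumes "finite R" and R_pos: "\<And>\<rho>. \<rho> \<in> R \<Longrightarrow> \<rho> > 0"
    and "m > 0" and \<sigma>: "\<And>x. \<sigma> x \<ge> m"
    and sol: "transmission_solution R \<sigma> w F"
    and lim: "(w \<longlongrightarrow> 0) at_infinity"
  shows "w x1 \<le> 0"
proof (rule ccontr)
  assume "\<not> w x1 \<le> 0"
  have harm: "harmonic_at w F x" if "norm x \<notin> R" for x
    using sol that by (simp add: transmission_solution_def)
  have deriv: "(w has_derivative F x) (at x)" if "norm x \<notin> R" for x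
    using harm[OF that] by (simp add: harmonic_at_def)
  have cont: "isCont w x" for x
  proof (cases "norm x \<in> R")
    case False
    show ?thesis
      by (rule has_derivative_continuous[OF deriv[OF False]])
  qed (use sol in \<open>simp add: transmission_solution_def\<close>)
  have cont_on: "continuous_on A w" for A
    by (rule continuous_at_imp_continuous_on) (use cont in blast)

  \<comment> \<open>A maximum point \<open>x0\<close> of largest possible norm.\<close>
  obtain B where B: "\<And>x. norm x \<ge> B \<Longrightarrow> w x < w x1"
    using order_tendstoD(2)[OF lim, of "w x1"] \<open>\<not> w x1 \<le> 0\<close>
    by (auto simp: eventually_at_infinity)
  define K where "K = cball (0 :: real ^ 3) (max B (norm x1))"
  have "compact K" "x1 \<in> K"
    by (auto simp: K_def)
  then obtain xm where xm: "xm \<in> K" "\<And>y. y \<in> K \<Longrightarrow> w y \<le> w xm"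
    using continuous_attains_sup[of K w] cont_on[of K] by blast
  define M where "M = w xm"
  have "w x1 \<le> M"
    using xm(2)[OF \<open>x1 \<in> K\<close>] by (simp add: M_def)
  have outside: "w y < M" if "y \<notin> K" for y
    using B[of y] that \<open>w x1 \<le> M\<close> by (simp add: K_def le_max_iff_disj)
  have max: "w y \<le> M" for y
    using xm(2)[of y] outside[of y] by (cases "y \<in> K") (auto simp: M_def)
  have "compact (K \<inter> w -` {M})"
    using \<open>compact K\<close> continuous_closed_preimage[OF cont_on[of K] compact_imp_closed[OF \<open>compact K\<close>], of "{M}"]
    by (simp add: compact_eq_bounded_closed bounded_Int)
  then obtain x0 where x0: "x0 \<in> K \<inter> w -` {M}" "\<And>y. y \<in> K \<inter> w -` {M} \<Longrightarrow> norm y \<le> norm x0"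
    using continuous_attains_sup[of "K \<inter> w -` {M}" norm] xm(1) by (auto simp: M_def intro: continuous_intros)
  define \<rho> where "\<rho> = norm x0"
  have "w x0 = M"
    using x0(1) by simp
  have far: "w y < M" if "norm y > \<rho>" for y
    using x0(2)[of y] that max[of y] outside[of y] by (cases "y \<in> K"; cases "w y = M") (auto simp: \<rho>_def)

  obtain d0 where d0: "d0 > 0" "\<And>s. \<bar>s - \<rho>\<bar> < d0 \<Longrightarrow> s \<noteq> \<rho> \<Longrightarrow> s \<notin> R"
  proof -
    have "open (- (R - {\<rho>}))"
      using \<open>finite R\<close> by (intro open_Compl finite_imp_closed finite_Diff)
    then obtain d0 where "d0 > 0" "ball \<rho> d0 \<subseteq> - (R - {\<rho>})"
      unfolding open_contains_ball by blast
    then show ?thesis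
      by (intro that[of d0]) (auto simp: dist_real_def subset_iff abs_minus_commute)
  qed
  define R0 where "R0 = \<rho> + d0 / 2"
  have "\<rho> \<ge> 0" "\<rho> < R0"
    using d0(1) by (auto simp: \<rho>_def R0_def)
  have no_interface: "s \<notin> R" if "\<rho> < s" "s < R0" for s
    using d0(2)[of s] that by (auto simp: R0_def)
  obtain M' where "M' < M" and M': "\<And>y. norm y = R0 \<Longrightarrow> w y \<le> M'"
  proof -
    have "R0 *\<^sub>R axis 1 1 \<in> sphere (0 :: real ^ 3) R0"
      using \<open>\<rho> \<ge> 0\<close> \<open>\<rho> < R0\<close> by simp
    then have "sphere (0 :: real ^ 3) R0 \<noteq> {}"
      by (metis empty_iff)
    from continuous_attains_sup[OF compact_sphere this cont_on]
    obtain xs where "xs \<in> sphere 0 R0" "\<And>y. y \<in> sphere 0 R0 \<Longrightarrow> w y \<le> w xs"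
      by blast
    then show ?thesis
      using far[of xs] \<open>\<rho> < R0\<close> by (intro that[of "w xs"]) auto
  qed

  show False
  proof (cases "\<rho> = 0")
    case True
    \<comment> \<open>The barrier is singular for \<open>\<rho> = 0\<close>, but then \<open>w\<close> is harmonic in a full ball.\<close>
    have "w x0 \<le> M'"
    proof (rule harmonic_maximum_principle[of "ball 0 R0" w F])
      show "harmonic_at w F x" if "x \<in> ball 0 R0" for x
        using that True R_pos[of 0] no_interface[of "norm x"] by (intro harm) (cases "x = 0"; auto)
    qed (use True \<open>\<rho> < R0\<close> cont_on M' in \<open>auto simp: \<rho>_def\<close>)
    with \<open>M' < M\<close> \<open>w x0 = M\<close> show False
      by simp
  next
    case False
    then have "\<rho> > 0"
      using \<open>\<rho> \<ge> 0\<close> by simp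
    \<comment> \<open>This value makes the barrier equal to \<open>M'\<close> on the sphere of radius \<open>R0\<close>.\<close>
    define \<delta> where "\<delta> = (M - M') / (inverse \<rho> - inverse R0)"
    have gap: "inverse \<rho> - inverse R0 > 0"
      using \<open>\<rho> > 0\<close> \<open>\<rho> < R0\<close> by simp
    have "\<delta> > 0"
      using gap \<open>M' < M\<close> by (simp add: \<delta>_def)
    have barrier: "w y + \<delta> * (inverse \<rho> - inverse (norm y)) \<le> M" if y: "\<rho> < norm y" "norm y < R0" for y
    proof -
      define U where "U = {y :: real ^ 3. \<rho> < norm y \<and> norm y < R0}"
      define C where "C = {y :: real ^ 3. \<rho> \<le> norm y \<and> norm y \<le> R0}"
      have "open U"
        unfolding U_def by (intro open_Collect_conj open_Collect_less continuous_intros)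
      have "closed C"
        unfolding C_def by (intro closed_Collect_conj closed_Collect_le continuous_intros)
      then have "closure U \<subseteq> C"
        by (intro closure_minimal) (auto simp: U_def C_def)
      have "bounded U"
        by (rule bounded_subset[of "ball 0 R0"]) (auto simp: U_def)
      show ?thesis
      proof (rule harmonic_maximum_principle[OF \<open>open U\<close> \<open>bounded U\<close>])
        show "y \<in> U"
          using y by (simp add: U_def)
        have "continuous_on (C) (\<lambda>y. w y + \<delta> * (inverse \<rho> - inverse (norm y)))"
          using \<open>\<rho> > 0\<close> by (intro continuous_intros cont_on) (auto simp: C_def)
        then show "continuous_on (closure U) (\<lambda>y. w y + \<delta> * (inverse \<rho> - inverse (norm y)))"
          using \<open>closure U \<subseteq> C\<close> continuous_on_subset by blast
        show "harmonic_at (\<lambda>y. w y + \<delta> * (inverse \<rho> - inverse (norm y)))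
            (\<lambda>y v. F y v + \<delta> *\<^sub>R (0 - (- (inverse (norm y) ^ 3) * inner y v))) x" if "x \<in> U" for x
        proof -
          have "x \<noteq> 0" "norm x \<notin> R"
            using that \<open>\<rho> > 0\<close> no_interface by (auto simp: U_def)
          then show ?thesis
            using harmonic_at_add[OF harm[of x] harmonic_at_scaleR[OF harmonic_at_diff[OF
                  harmonic_at_const[of "inverse \<rho>"] harmonic_at_inverse_norm], of x \<delta>]]
            by simp
        qed
        show "w x + \<delta> * (inverse \<rho> - inverse (norm x)) \<le> M" if "x \<in> frontier U" for x
        proof -
          have "x \<in> C" "x \<notin> U"
            using that \<open>closure U \<subseteq> C\<close> \<open>open U\<close> by (auto simp: frontier_def interior_open)
          then consider "norm x = \<rho>" | "norm x = R0"
            by (auto simp: U_def C_def)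
          then show ?thesis
          proof cases
            case 2
            then show ?thesis
              using M'[of x] gap \<open>\<rho> < R0\<close> by (simp add: \<delta>_def)
          qed (use max[of x] in simp)
        qed
      qed
    qed

    \<comment> \<open>From here on everything happens on the ray through \<open>x0\<close>.\<close>
    define e where "e = sgn x0"
    define g where "g s = w (s *\<^sub>R e)" for s
    have e: "norm e = 1" "x0 = \<rho> *\<^sub>R e"
      using \<open>\<rho> > 0\<close> by (auto simp: e_def \<rho>_def norm_sgn sgn_div_norm)
    have "g \<rho> = M"
      using \<open>w x0 = M\<close> e(2) by (simp add: g_def)
    have dg: "(g has_real_derivative F (s *\<^sub>R e) e) (at s)" if "s > 0" "s \<notin> R" for s
    proof -
      have dw: "(w has_derivative F (s *\<^sub>R e)) (at (s *\<^sub>R e))"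
        using that e(1) by (intro deriv) simp
      have "((\<lambda>s. s *\<^sub>R e) has_derivative (\<lambda>h. h *\<^sub>R e)) (at s)"
        by (auto intro!: derivative_eq_intros)
      from has_derivative_compose[OF this dw] show ?thesis
        unfolding g_def
        by (rule has_derivative_imp_has_field_derivative)
           (simp add: linear_scale[OF bounded_linear.linear[OF has_derivative_bounded_linear[OF dw]]])
    qed
    have mvt: "\<exists>z. a < z \<and> z < b \<and> g b - g a = (b - a) * F (z *\<^sub>R e) e"
      if "0 < a" "a < b" "\<And>s. a < s \<Longrightarrow> s < b \<Longrightarrow> s \<notin> R" for a b
    proof -
      have "continuous_on {a..b} g"
        unfolding g_def
        by (rule continuous_on_compose2[OF cont_on[of UNIV]]) (auto intro!: continuous_intros)
      moreover have "(g has_derivative (\<lambda>h. h * F (s *\<^sub>R e) e)) (at s)" if "a < s" "s < b" for s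
        using dg[of s] that \<open>0 < a\<close> \<open>\<And>s. a < s \<Longrightarrow> s < b \<Longrightarrow> s \<notin> R\<close>
        by (simp add: has_field_derivative_def mult_commute_abs)
      ultimately obtain z where "a < z" "z < b" "g b - g a = (b - a) * F (z *\<^sub>R e) e"
        by (rule mvt[OF \<open>a < b\<close>])
      then show ?thesis
        by blast
    qed
    have ray: "sgn (z *\<^sub>R e) = e"
        "z *\<^sub>R e \<noteq> x0" "norm (z *\<^sub>R e) \<noteq> norm x0" "dist (z *\<^sub>R e) x0 = \<bar>z - \<rho>\<bar>"
      if "z > 0" "z \<noteq> \<rho>" for z
    proof -
      show "norm (z *\<^sub>R e) \<noteq> norm x0"
        using that e \<open>\<rho> > 0\<close> by simp
      then show "z *\<^sub>R e \<noteq> x0"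
        by auto
      have "dist (z *\<^sub>R e) x0 = norm ((z - \<rho>) *\<^sub>R e)"
        unfolding e(2) dist_norm by (simp only: scaleR_diff_left)
      then show "dist (z *\<^sub>R e) x0 = \<bar>z - \<rho>\<bar>"
        using e(1) by simp
    qed (use that e in \<open>simp add: sgn_scaleR sgn_div_norm\<close>)

    show False
    proof (cases "\<rho> \<in> R")
      case False
      then have "F x0 = (\<lambda>v. 0)"
        using max \<open>w x0 = M\<close> deriv[of x0]
        by (intro differential_zero_maxmin[of x0 UNIV w]) (auto simp: \<rho>_def)
      then have "(g has_real_derivative 0) (at \<rho>)"
        using dg[OF \<open>\<rho> > 0\<close> False] e(2) by simp
      then have "((\<lambda>s. g s + \<delta> * (inverse \<rho> - inverse s)) has_real_derivative
          0 + \<delta> * (0 - (- (inverse \<rho> * 1 * inverse \<rho>)))) (at \<rho>)"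
        using \<open>\<rho> > 0\<close> by (intro DERIV_add DERIV_cmult DERIV_diff DERIV_const DERIV_inverse' DERIV_ident) auto
      moreover have "0 + \<delta> * (0 - (- (inverse \<rho> * 1 * inverse \<rho>))) > 0"
        using \<open>\<delta> > 0\<close> \<open>\<rho> > 0\<close> by simp
      ultimately obtain d where d: "d > 0" "\<And>h. 0 < h \<Longrightarrow> h < d \<Longrightarrow>
          g \<rho> + \<delta> * (inverse \<rho> - inverse \<rho>) < g (\<rho> + h) + \<delta> * (inverse \<rho> - inverse (\<rho> + h))"
        using DERIV_pos_inc_right by blast
      define h where "h = min d (R0 - \<rho>) / 2"
      have h: "0 < h" "h < d" "\<rho> + h < R0"
        using d(1) \<open>\<rho> < R0\<close> by (auto simp: h_def min_def field_simps)
      show False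
        using d(2)[OF h(1,2)] barrier[of "(\<rho> + h) *\<^sub>R e"] h e(1) \<open>g \<rho> = M\<close> \<open>\<rho> > 0\<close>
        by (simp add: g_def)
    next
      case True
      then obtain L where L: "((\<lambda>y. \<sigma> y *\<^sub>R F y (sgn y)) \<longlongrightarrow> L) (at x0 within {y. norm y \<noteq> norm x0})"
        using sol by (auto simp: transmission_solution_def \<rho>_def)
      have "L \<ge> 0"
      proof (rule ccontr)
        assume "\<not> L \<ge> 0"
        then obtain d where d: "d > 0" "\<And>y. norm y \<noteq> norm x0 \<Longrightarrow> y \<noteq> x0 \<Longrightarrow> dist y x0 < d \<Longrightarrow>
            \<sigma> y *\<^sub>R F y (sgn y) < 0"
          using order_tendstoD(2)[OF L, of 0] by (auto simp: eventually_at)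
        define s where "s = \<rho> - min d (min d0 \<rho>) / 2"
        have s: "0 < s" "s < \<rho>" "\<rho> - s < d" "\<rho> - s < d0"
          using d(1) d0(1) \<open>\<rho> > 0\<close> by (auto simp: s_def min_def field_simps)
        obtain z where z: "s < z" "z < \<rho>" "g \<rho> - g s = (\<rho> - s) * F (z *\<^sub>R e) e"
          using mvt[OF s(1,2)] s d0(2) by force
        have "\<sigma> (z *\<^sub>R e) * F (z *\<^sub>R e) e < 0"
          using d(2)[of "z *\<^sub>R e"] ray[of z] z s by simp
        moreover have "\<sigma> (z *\<^sub>R e) > 0"
          using \<sigma>[of "z *\<^sub>R e"] \<open>m > 0\<close> by simp
        ultimately have "F (z *\<^sub>R e) e < 0"
          by (simp add: mult_less_0_iff)
        then have "(\<rho> - s) * F (z *\<^sub>R e) e < 0"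
          using s(2) by (simp add: mult_less_0_iff)
        then show False
          using z(3) max[of "s *\<^sub>R e"] \<open>g \<rho> = M\<close> by (simp add: g_def)
      qed
      define c where "c = \<delta> / R0\<^sup>2"
      have "c > 0"
        using \<open>\<delta> > 0\<close> \<open>\<rho> < R0\<close> \<open>\<rho> > 0\<close> by (simp add: c_def)
      have "L \<le> - (m * c)"
      proof (rule ccontr)
        assume "\<not> L \<le> - (m * c)"
        then obtain d where d: "d > 0" "\<And>y. norm y \<noteq> norm x0 \<Longrightarrow> y \<noteq> x0 \<Longrightarrow> dist y x0 < d \<Longrightarrow>
            \<sigma> y *\<^sub>R F y (sgn y) > - (m * c)"
          using order_tendstoD(1)[OF L, of "- (m * c)"] by (auto simp: eventually_at)
        define s where "s = \<rho> + min d (R0 - \<rho>) / 2"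
        have s: "\<rho> < s" "s < R0" "s - \<rho> < d"
          using d(1) \<open>\<rho> < R0\<close> by (auto simp: s_def min_def field_simps)
        obtain z where z: "\<rho> < z" "z < s" "g s - g \<rho> = (s - \<rho>) * F (z *\<^sub>R e) e"
          using mvt[OF \<open>\<rho> > 0\<close> s(1)] s no_interface by force
        have "(s - \<rho>) * F (z *\<^sub>R e) e \<le> - (\<delta> * (inverse \<rho> - inverse s))"
          using barrier[of "s *\<^sub>R e"] z(3) e(1) s \<open>g \<rho> = M\<close> \<open>\<rho> > 0\<close> by (simp add: g_def)
        also have "inverse \<rho> - inverse s = (s - \<rho>) * (inverse \<rho> * inverse s)"
          using \<open>\<rho> > 0\<close> s by (simp add: field_simps)
        finally have "(s - \<rho>) * F (z *\<^sub>R e) e \<le> (s - \<rho>) * (- (\<delta> * (inverse \<rho> * inverse s)))"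
          by (simp add: algebra_simps)
        then have "F (z *\<^sub>R e) e \<le> - (\<delta> * (inverse \<rho> * inverse s))"
          using s(1) by (simp only: mult_le_cancel_left_pos[of "s - \<rho>"] diff_gt_0_iff_gt)
        moreover have "inverse R0 * inverse R0 \<le> inverse \<rho> * inverse s"
          using \<open>\<rho> > 0\<close> \<open>\<rho> < R0\<close> s by (intro mult_mono) auto
        then have "c \<le> \<delta> * (inverse \<rho> * inverse s)"
          using \<open>\<delta> > 0\<close> by (simp add: c_def divide_inverse power2_eq_square)
        ultimately have F: "F (z *\<^sub>R e) e \<le> - c"
          by linarith
        have "m * c \<le> \<sigma> (z *\<^sub>R e) * (- F (z *\<^sub>R e) e)"
          using F \<sigma>[of "z *\<^sub>R e"] \<open>c > 0\<close> \<open>m > 0\<close> by (intro mult_mono) auto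
        moreover have "\<sigma> (z *\<^sub>R e) * F (z *\<^sub>R e) e > - (m * c)"
          using d(2)[of "z *\<^sub>R e"] ray[of z] z s \<open>\<rho> > 0\<close> by simp
        ultimately show False
          by simp
      qed
      moreover have "m * c > 0"
        using \<open>m > 0\<close> \<open>c > 0\<close> by simp
      ultimately show False
        using \<open>L \<ge> 0\<close> by simp
    qed
  qed
qed

text \<open>The vector-valued case reduces to the scalar one by testing with the fixed vector \<open>w x\<close>.\<close>

lemma transmission_solution_unique:
  fixes w :: "real ^ 3 \<Rightarrow> 'a::real_inner"
  assumes "finite R" "\<And>\<rho>. \<rho> \<in> R \<Longrightarrow> \<rho> > 0" "m > 0" "\<And>x. \<sigma> x \<ge> m"
    and sol: "transmission_solution R \<sigma> w F"
    and lim: "(w \<longlongrightarrow> 0) at_infinity"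
  shows "w x = 0"
proof -
  have "inner (w x) (w x) \<le> 0"
  proof (rule transmission_solution_nonpos[OF assms(1-4), where w = "\<lambda>y. inner (w x) (w y)"])
    show "transmission_solution R \<sigma> (\<lambda>y. inner (w x) (w y)) (\<lambda>y v. inner (w x) (F y v))"
      by (rule transmission_solution_bounded_linear[OF bounded_linear_inner_right sol])
    show "((\<lambda>y. inner (w x) (w y)) \<longlongrightarrow> 0) at_infinity"
      using tendsto_inner[OF tendsto_const lim, of "w x"] by simp
  qed
  then show ?thesis
    by (metis inner_eq_zero_iff inner_ge_zero order_antisym)
qed

section \<open>The potential of a charged sphere\<close>

text \<open>The continuous function, decaying if \<open>h\<close> is linear, that equals \<open>h\<close> inside the sphere of radius
  \<open>\<rho>\<close> and \<open>\<rho>\<^sup>3 h / |y|\<^sup>3\<close> outside: the single-layer potential of a surface charge. Writing both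
  cases with one maximum makes continuity across the sphere evident.\<close>

definition sphere_potential ::
  "real \<Rightarrow> (real ^ 3 \<Rightarrow> 'a::real_normed_vector) \<Rightarrow> real ^ 3 \<Rightarrow> 'a" where
  "sphere_potential \<rho> h y = (\<rho> / max \<rho> (norm y)) ^ 3 *\<^sub>R h y"

text \<open>On the sphere itself, where the potential has a kink, the inner formula is the default value.\<close>

definition sphere_potential_deriv ::
  "real \<Rightarrow> (real ^ 3 \<Rightarrow> 'a::real_normed_vector) \<Rightarrow> real ^ 3 \<Rightarrow> real ^ 3 \<Rightarrow> 'a" where
  "sphere_potential_deriv \<rho> h y v =
     (if norm y > \<rho>
      then \<rho> ^ 3 *\<^sub>R (inverse (norm y) ^ 3 *\<^sub>R h v - (3 * inverse (norm y) ^ 5 * inner y v) *\<^sub>R h y)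
      else h v)"

lemma sphere_potential_outside:
  "\<rho> \<le> norm y \<Longrightarrow> sphere_potential \<rho> h y = \<rho> ^ 3 *\<^sub>R (inverse (norm y) ^ 3 *\<^sub>R h y)"
  by (simp add: sphere_potential_def max_absorb2 divide_inverse power_mult_distrib)

lemma sphere_potential_inside:
  "0 < \<rho> \<Longrightarrow> norm y \<le> \<rho> \<Longrightarrow> sphere_potential \<rho> h y = h y"
  by (simp add: sphere_potential_def max_absorb1)

lemma harmonic_at_sphere_potential:
  assumes h: "bounded_linear h" and "\<rho> > 0" "norm x \<noteq> \<rho>"
  shows "harmonic_at (sphere_potential \<rho> h) (sphere_potential_deriv \<rho> h) x"
proof (cases "norm x > \<rho>")
  case True
  have "open {y :: real ^ 3. \<rho> < norm y}"
    by (intro open_Collect_less continuous_intros)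
  moreover have "x \<noteq> 0"
    using True \<open>\<rho> > 0\<close> by auto
  ultimately show ?thesis
    using True by (intro harmonic_at_cong_open[OF harmonic_at_scaleR[OF harmonic_at_dipole[OF h], of x "\<rho> ^ 3"]])
      (auto simp: sphere_potential_outside sphere_potential_deriv_def fun_eq_iff)
next
  case False
  then show ?thesis
    using assms by (intro harmonic_at_cong_open[OF harmonic_at_linear[OF h], of "ball 0 \<rho>"])
      (auto simp: sphere_potential_inside sphere_potential_deriv_def fun_eq_iff)
qed

lemma isCont_sphere_potential:
  assumes "bounded_linear h" "\<rho> > 0"
  shows "isCont (sphere_potential \<rho> h) x"
  unfolding sphere_potential_def using assms(2)
  by (intro continuous_intros bounded_linear.isCont[OF assms(1)]) auto

text \<open>The radial derivative jumps from \<open>1\<close> to \<open>-2\<close> times \<open>h (sgn y)\<close> across the sphere; this jump produces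
  the diagonal entries of the matrix.\<close>

lemma sphere_potential_deriv_radial:
  assumes "bounded_linear h" "y \<noteq> 0"
  shows "sphere_potential_deriv \<rho> h y (sgn y)
    = (if norm y > \<rho> then - 2 * (\<rho> / norm y) ^ 3 else 1) *\<^sub>R h (sgn y)"
proof -
  have "h y = norm y *\<^sub>R h (sgn y)"
    using assms by (simp add: sgn_div_norm linear_scale[OF bounded_linear.linear[OF assms(1)]])
  moreover have "inner y (sgn y) = norm y"
    using assms(2) by (simp add: sgn_div_norm power2_norm_eq_inner[symmetric] power2_eq_square)
  moreover have "\<rho> ^ 3 * (inverse (norm y) ^ 3 - 3 * inverse (norm y) ^ 5 * norm y * norm y) = - 2 * (\<rho> / norm y) ^ 3"
    using assms(2) by (simp add: field_simps numeral_eq_Suc)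
  ultimately show ?thesis
    by (simp add: sphere_potential_deriv_def flip: scaleR_left_diff_distrib)
qed

lemma dipole_tendsto_0:
  fixes h :: "real ^ 3 \<Rightarrow> 'a::real_normed_vector"
  assumes "bounded_linear h"
  shows "((\<lambda>y. inverse (norm y) ^ 3 *\<^sub>R h y) \<longlongrightarrow> 0) at_infinity"
proof -
  obtain K where K: "\<And>y. norm (h y) \<le> norm y * K"
    using bounded_linear.bounded[OF assms] by blast
  show ?thesis
  proof (rule Lim_null_comparison)
    have "norm (inverse (norm y) ^ 3 *\<^sub>R h y) \<le> inverse (norm y) ^ 2 * K" if "norm y \<ge> 1" for y
    proof -
      have "norm (inverse (norm y) ^ 3 *\<^sub>R h y) \<le> inverse (norm y) ^ 3 * (norm y * K)"
        using K[of y] by (simp add: mult_left_mono)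
      also have "\<dots> = inverse (norm y) ^ 2 * K"
        using that by (auto simp: field_simps numeral_eq_Suc)
      finally show ?thesis .
    qed
    then show "\<forall>\<^sub>F y in at_infinity. norm (inverse (norm y) ^ 3 *\<^sub>R h y) \<le> inverse (norm y) ^ 2 * K"
      unfolding eventually_at_infinity by blast
    have "((\<lambda>y :: real ^ 3. inverse (norm y)) \<longlongrightarrow> 0) at_infinity"
      by (rule tendsto_inverse_0_at_top[OF filterlim_norm_at_top])
    from tendsto_mult[OF tendsto_power[OF this, of 2] tendsto_const[of K]]
    show "((\<lambda>y :: real ^ 3. inverse (norm y) ^ 2 * K) \<longlongrightarrow> 0) at_infinity"
      by simp
  qed
qed

section \<open>The layers and their interfaces\<close>

locale layers =
  fixes N :: nat and r :: "nat \<Rightarrow> real"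
  assumes N_pos: "N \<ge> 1"
    and radii_step: "\<And>j. 1 \<le> j \<Longrightarrow> j < N \<Longrightarrow> r j > r (j + 1)"
    and radius_N_pos: "r N > 0"
begin

lemma radii_less:
  assumes "1 \<le> i" "i < j" "j \<le> N"
  shows "r j < r i"
proof -
  have "i \<le> k \<Longrightarrow> Suc k \<le> N \<Longrightarrow> r (Suc k) < r i" for k
  proof (induction k rule: dec_induct)
    case base
    then show ?case using radii_step[of i] assms(1) by simp
  next
    case (step k)
    then show ?case using radii_step[of "Suc k"] by simp
  qed
  from this[of "j - 1"] show ?thesis
    using assms(2,3) by simp
qed

lemma radii_le: "1 \<le> i \<Longrightarrow> i \<le> j \<Longrightarrow> j \<le> N \<Longrightarrow> r j \<le> r i"
  using radii_less[of i j] by (cases "i = j") auto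

lemma radii_pos: "1 \<le> i \<Longrightarrow> i \<le> N \<Longrightarrow> r i > 0"
  using radii_le[of i N] radius_N_pos by linarith

definition radii :: "real set" where
  "radii = r ` {1..N}"

lemma layer_exists: "\<exists>k\<le>N. x \<in> layer N r k \<and> (norm x \<notin> radii \<longrightarrow> x \<in> interior (layer N r k))"
proof (cases "norm x > r 1")
  case True
  have "open {y :: real ^ 3. r 1 < norm y}"
    by (intro open_Collect_less continuous_intros)
  then show ?thesis
    using True by (intro exI[of _ 0]) (simp add: layer_def interior_open)
next
  case False
  define k where "k = Max {j \<in> {1..N}. norm x \<le> r j}"
  have "finite {j \<in> {1..N}. norm x \<le> r j}" "1 \<in> {j \<in> {1..N}. norm x \<le> r j}"
    using False N_pos by auto
  then have "k \<in> {j \<in> {1..N}. norm x \<le> r j}"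
      and above: "\<And>j. j \<in> {1..N} \<Longrightarrow> norm x \<le> r j \<Longrightarrow> j \<le> k"
    unfolding k_def by (metis (no_types, lifting) Max_in empty_iff, simp)
  then have k: "1 \<le> k" "k \<le> N" "norm x \<le> r k"
    by auto
  have "norm x \<notin> radii \<Longrightarrow> norm x < r k"
    using k by (force simp: radii_def)
  show ?thesis
  proof (cases "k < N")
    case True
    then have "norm x > r (k + 1)"
      using above[of "k + 1"] by force
    have "open {y :: real ^ 3. r (k + 1) < norm y \<and> norm y < r k}"
      by (intro open_Collect_conj open_Collect_less continuous_intros)
    moreover have "{y :: real ^ 3. r (k + 1) < norm y \<and> norm y < r k} \<subseteq> layer N r k"
      using True k by (auto simp: layer_def)
    ultimately have "{y :: real ^ 3. r (k + 1) < norm y \<and> norm y < r k} \<subseteq> interior (layer N r k)"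
      by (simp add: interior_maximal)
    then show ?thesis
      using k True \<open>norm x > r (k + 1)\<close> \<open>norm x \<notin> radii \<Longrightarrow> norm x < r k\<close>
      by (intro exI[of _ k]) (auto simp: layer_def)
  next
    case False
    then have "k = N"
      using k by simp
    then have "ball 0 (r k) \<subseteq> layer N r k"
      using N_pos by (auto simp: layer_def)
    then have "ball 0 (r k) \<subseteq> interior (layer N r k)"
      by (simp add: interior_maximal)
    then show ?thesis
      using k \<open>k = N\<close> N_pos \<open>norm x \<notin> radii \<Longrightarrow> norm x < r k\<close>
      by (intro exI[of _ k]) (auto simp: layer_def)
  qed
qed

lemma coefficient_bounded_below:
  assumes "\<And>j. j \<le> N \<Longrightarrow> \<epsilon> j > 0" "\<And>j x. j \<le> N \<Longrightarrow> x \<in> layer N r j \<Longrightarrow> \<sigma> x = \<epsilon> j"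
  shows "\<exists>m>0. \<forall>x. \<sigma> x \<ge> (m :: real)"
proof (intro exI conjI allI)
  show "Min (\<epsilon> ` {..N}) > 0"
    using assms(1) by (subst Min_gr_iff) auto
  show "\<sigma> x \<ge> Min (\<epsilon> ` {..N})" for x
    using layer_exists[of x] assms(2) by fastforce
qed

text \<open>This lemma and the next one identify the coefficient on either side of an interface. The
  neighbourhood is needed to stay away from the adjacent interface.\<close>

lemma eventually_outer_layer:
  assumes "1 \<le> i" "i \<le> N" "norm x = r i"
  shows "\<forall>\<^sub>F y in at x within {y. norm y > r i}. y \<in> layer N r (i - 1)"
proof (cases "i = 1")
  case True
  then show ?thesis
    by (simp add: layer_def eventually_at_filter)
next
  case False
  have "open {y :: real ^ 3. norm y < r (i - 1)}"
    by (intro open_Collect_less continuous_intros)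
  moreover have "x \<in> {y. norm y < r (i - 1)}"
    using radii_less[of "i - 1" i] assms False by simp
  ultimately have "\<forall>\<^sub>F y in nhds x. y \<in> {y. norm y < r (i - 1)}"
    by (rule eventually_nhds_in_open)
  then show ?thesis
    unfolding eventually_at_filter
    by (rule eventually_mono) (use assms False in \<open>auto simp: layer_def\<close>)
qed

lemma eventually_inner_layer:
  assumes "1 \<le> i" "i \<le> N" "norm x = r i"
  shows "\<forall>\<^sub>F y in at x within {y. norm y < r i}. y \<in> layer N r i"
proof (cases "i = N")
  case True
  then show ?thesis
    using N_pos by (simp add: layer_def eventually_at_filter)
next
  case False
  have "open {y :: real ^ 3. r (i + 1) < norm y}"
    by (intro open_Collect_less continuous_intros)
  moreover have "x \<in> {y. r (i + 1) < norm y}"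
    using radii_less[of i "i + 1"] assms False by simp
  ultimately have "\<forall>\<^sub>F y in nhds x. y \<in> {y. r (i + 1) < norm y}"
    by (rule eventually_nhds_in_open)
  then show ?thesis
    unfolding eventually_at_filter
    by (rule eventually_mono) (use assms False in \<open>auto simp: layer_def\<close>)
qed

lemma layered_solution_imp_transmission_solution:
  assumes "layered_solution N r \<sigma> u"
  shows "transmission_solution radii \<sigma> u (\<lambda>y. frechet_derivative u (at y))"
  unfolding transmission_solution_def
proof (intro conjI allI impI)
  fix x :: "real ^ 3"
  assume "norm x \<notin> radii"
  then obtain k where "k \<le> N" "x \<in> interior (layer N r k)"
    using layer_exists by blast
  then show "harmonic_at u (\<lambda>y. frechet_derivative u (at y)) x"
    using assms by (intro harmonic_on_imp_harmonic_at[of u "interior (layer N r k)"])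
      (auto simp: layered_solution_def)
next
  fix x :: "real ^ 3"
  assume "norm x \<in> radii"
  then obtain j where "j \<in> {1..N}" "norm x = r j"
    by (auto simp: radii_def)
  then show "isCont u x" "\<exists>L. ((\<lambda>y. \<sigma> y *\<^sub>R frechet_derivative u (at y) (sgn y)) \<longlongrightarrow> L)
      (at x within {y. norm y \<noteq> norm x})"
    using assms by (auto simp: layered_solution_def radial_deriv_def)
qed

section \<open>Superpositions of sphere potentials\<close>

text \<open>The background \<open>b h\<close> perturbed by charges \<open>c\<^sub>1, \<dots>, c\<^sub>N\<close> on the interfaces. The case \<open>b = 1\<close> gives the
  solution of the problem, the case \<open>b = 0\<close> shows that the matrix is injective.\<close>

definition layered_field ::
  "real \<Rightarrow> (nat \<Rightarrow> real) \<Rightarrow> (real ^ 3 \<Rightarrow> 'a::real_normed_vector) \<Rightarrow> real ^ 3 \<Rightarrow> 'a" where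
  "layered_field b c h y = b *\<^sub>R h y + (\<Sum>j\<in>{1..N}. c j *\<^sub>R sphere_potential (r j) h y)"

definition layered_field_deriv ::
  "real \<Rightarrow> (nat \<Rightarrow> real) \<Rightarrow> (real ^ 3 \<Rightarrow> 'a::real_normed_vector) \<Rightarrow> real ^ 3 \<Rightarrow> real ^ 3 \<Rightarrow> 'a" where
  "layered_field_deriv b c h y v = b *\<^sub>R h v + (\<Sum>j\<in>{1..N}. c j *\<^sub>R sphere_potential_deriv (r j) h y v)"

lemma layered_field_outside:
  assumes "norm y \<ge> r 1"
  shows "layered_field b c h y = b *\<^sub>R h y + (\<Sum>j\<in>{1..N}. c j * r j ^ 3) *\<^sub>R (inverse (norm y) ^ 3 *\<^sub>R h y)"
proof -
  have "sphere_potential (r j) h y = r j ^ 3 *\<^sub>R (inverse (norm y) ^ 3 *\<^sub>R h y)" if "j \<in> {1..N}" for j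
    using radii_le[of 1 j] assms that by (intro sphere_potential_outside) auto
  then have "(\<Sum>j\<in>{1..N}. c j *\<^sub>R sphere_potential (r j) h y)
      = (\<Sum>j\<in>{1..N}. (c j * r j ^ 3) *\<^sub>R (inverse (norm y) ^ 3 *\<^sub>R h y))"
    by (intro sum.cong refl) (simp add: mult.assoc)
  then show ?thesis
    by (simp only: layered_field_def scaleR_sum_left)
qed

lemma layered_field_diff_tendsto_0:
  assumes "bounded_linear h"
  shows "((\<lambda>y. layered_field b c h y - b *\<^sub>R h y) \<longlongrightarrow> 0) at_infinity"
proof -
  have "\<forall>\<^sub>F y in at_infinity. norm y \<ge> r 1"
    unfolding eventually_at_infinity by blast
  then have "\<forall>\<^sub>F y in at_infinity. (\<Sum>j\<in>{1..N}. c j * r j ^ 3) *\<^sub>R (inverse (norm y) ^ 3 *\<^sub>R h y)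
      = layered_field b c h y - b *\<^sub>R h y"
    by eventually_elim (simp add: layered_field_outside)
  moreover have "((\<lambda>y. (\<Sum>j\<in>{1..N}. c j * r j ^ 3) *\<^sub>R (inverse (norm y) ^ 3 *\<^sub>R h y)) \<longlongrightarrow> 0) at_infinity"
    using tendsto_scaleR[OF tendsto_const dipole_tendsto_0[OF assms]] by simp
  ultimately show ?thesis
    by (rule Lim_transform_eventually[rotated])
qed

text \<open>The radial derivative at the \<open>i\<close>-th interface, as a multiple of \<open>h (sgn y)\<close>, of the potential of a
  different interface \<open>j\<close>: if the latter is inside (\<open>j > i\<close>), its dipole field is felt, otherwise its
  linear field. Up to the sign this is the entry \<open>(j, i)\<close> of the matrix \<open>P\<close>.\<close>

definition interface_coupling :: "nat \<Rightarrow> nat \<Rightarrow> real" where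
  "interface_coupling i j = (if j > i then - 2 * (r j / r i) ^ 3 else 1)"

text \<open>Let \<open>S\<close> be the sum in the \<open>i\<close>-th equation. The flux through the \<open>i\<close>-th interface tends to
  \<open>\<epsilon>\<^sub>i\<^sub>-\<^sub>1 (b + S - 2 c\<^sub>i)\<close> from outside and to \<open>\<epsilon>\<^sub>i (b + S + c\<^sub>i)\<close> from inside, times the same value of \<open>h\<close>. These
  agree when \<open>(2 \<epsilon>\<^sub>i\<^sub>-\<^sub>1 + \<epsilon>\<^sub>i) c\<^sub>i = (\<epsilon>\<^sub>i\<^sub>-\<^sub>1 - \<epsilon>\<^sub>i) (b + S)\<close>; division by
  \<open>\<epsilon>\<^sub>i\<^sub>-\<^sub>1 - \<epsilon>\<^sub>i\<close> turns this into \<open>\<lambda>\<^sub>i c\<^sub>i - S = b\<close>.\<close>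

lemma layered_field_transmission_solution:
  fixes h :: "real ^ 3 \<Rightarrow> 'a::real_normed_vector"
  assumes h: "bounded_linear h"
    and \<epsilon>_neq: "\<And>j. 1 \<le> j \<Longrightarrow> j \<le> N \<Longrightarrow> \<epsilon> (j - 1) \<noteq> \<epsilon> j"
    and \<sigma>: "\<And>j x. j \<le> N \<Longrightarrow> x \<in> layer N r j \<Longrightarrow> \<sigma> x = \<epsilon> j"
    and eqn: "\<And>i. i \<in> {1..N} \<Longrightarrow>
      lam \<epsilon> i * c i - (\<Sum>j\<in>{1..N} - {i}. interface_coupling i j * c j) = b"
  shows "transmission_solution radii \<sigma> (layered_field b c h) (layered_field_deriv b c h)"
  unfolding transmission_solution_def
proof (intro conjI allI impI)
  fix x :: "real ^ 3"
  assume "norm x \<notin> radii"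
  then show "harmonic_at (layered_field b c h) (layered_field_deriv b c h) x"
    unfolding layered_field_def[abs_def] layered_field_deriv_def[abs_def]
    by (intro harmonic_at_add harmonic_at_sum harmonic_at_scaleR harmonic_at_linear h
        harmonic_at_sphere_potential) (auto simp: radii_def radii_pos)
next
  fix x :: "real ^ 3"
  show "isCont (layered_field b c h) x"
    unfolding layered_field_def[abs_def]
    by (intro continuous_intros bounded_linear.isCont[OF h] isCont_sphere_potential[OF h])
       (auto simp: radii_pos)
next
  fix x :: "real ^ 3"
  assume "norm x \<in> radii"
  then obtain i where i: "1 \<le> i" "i \<le> N" "norm x = r i"
    by (auto simp: radii_def)
  then have "x \<noteq> 0"
    using radii_pos[of i] by auto
  \<comment> \<open>The ratio of the radial derivative to \<open>h (sgn y)\<close> at radius \<open>s\<close>, where \<open>J\<close> collects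
     the interfaces that do not lie inside radius \<open>s\<close>. As \<open>J\<close> is constant on a layer, the profile is
     continuous in \<open>s\<close> up to the interface.\<close>
  define profile :: "nat set \<Rightarrow> real \<Rightarrow> real" where
    "profile J s = b + (\<Sum>j\<in>{1..N}. c j * (if j \<in> J then 1 else - 2 * (r j / s) ^ 3))" for J s
  have flux: "layered_field_deriv b c h y (sgn y) = profile J (norm y) *\<^sub>R h (sgn y)"
    if "y \<noteq> 0" "\<And>j. j \<in> {1..N} \<Longrightarrow> j \<in> J \<longleftrightarrow> norm y \<le> r j" for y J
  proof -
    have "layered_field_deriv b c h y (sgn y)
        = b *\<^sub>R h (sgn y) + (\<Sum>j\<in>{1..N}. (c j * (if j \<in> J then 1 else - 2 * (r j / norm y) ^ 3)) *\<^sub>R h (sgn y))"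
      unfolding layered_field_deriv_def
      by (intro arg_cong2[where f = "(+)"] refl sum.cong)
         (use that in \<open>auto simp: sphere_potential_deriv_radial[OF h] not_less\<close>)
    then show ?thesis
      by (simp add: profile_def scaleR_left_distrib scaleR_sum_left)
  qed
  have lim: "((\<lambda>y. \<sigma> y *\<^sub>R layered_field_deriv b c h y (sgn y)) \<longlongrightarrow>
        (\<epsilon> k * profile J (r i)) *\<^sub>R h (sgn x)) (at x within S)"
    if "k \<le> N" "\<forall>\<^sub>F y in at x within S. y \<in> layer N r k \<and> (\<forall>j\<in>{1..N}. j \<in> J \<longleftrightarrow> norm y \<le> r j)" for k J S
  proof -
    have "\<forall>\<^sub>F y in at x within S. y \<noteq> 0"
      by (rule tendsto_imp_eventually_ne[OF tendsto_ident_at \<open>x \<noteq> 0\<close>])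
    with that(2) have "\<forall>\<^sub>F y in at x within S. (\<epsilon> k * profile J (norm y)) *\<^sub>R h (sgn y)
        = \<sigma> y *\<^sub>R layered_field_deriv b c h y (sgn y)"
      by eventually_elim (use flux[of _ J] \<sigma>[OF \<open>k \<le> N\<close>] in auto)
    moreover have "((\<lambda>y. profile J (norm y)) \<longlongrightarrow> profile J (r i)) (at x within S)"
    proof -
      have "((\<lambda>y. if j \<in> J then 1 else - 2 * (r j / norm y) ^ 3) \<longlongrightarrow>
          (if j \<in> J then 1 else - 2 * (r j / r i) ^ 3)) (at x within S)" for j
        using \<open>x \<noteq> 0\<close> by (auto simp flip: i(3) intro!: tendsto_eq_intros)
      then show ?thesis
        unfolding profile_def by (intro tendsto_add tendsto_const tendsto_sum tendsto_mult)
    qed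
    then have "((\<lambda>y. (\<epsilon> k * profile J (norm y)) *\<^sub>R h (sgn y)) \<longlongrightarrow>
        (\<epsilon> k * profile J (r i)) *\<^sub>R h (sgn x)) (at x within S)"
      using \<open>x \<noteq> 0\<close>
      by (intro tendsto_scaleR tendsto_mult tendsto_const bounded_linear.tendsto[OF h] tendsto_sgn tendsto_ident_at)
    ultimately show ?thesis
      by (rule Lim_transform_eventually[rotated])
  qed
  have outer: "((\<lambda>y. \<sigma> y *\<^sub>R layered_field_deriv b c h y (sgn y)) \<longlongrightarrow>
      (\<epsilon> (i - 1) * profile {..<i} (r i)) *\<^sub>R h (sgn x)) (at x within {y. norm y > r i})"
  proof (rule lim)
    have "\<forall>\<^sub>F y in at x within {y. norm y > r i}. norm y > r i"
      by (simp add: eventually_at_filter)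
    with eventually_outer_layer[OF i]
    show "\<forall>\<^sub>F y in at x within {y. norm y > r i}. y \<in> layer N r (i - 1) \<and>
        (\<forall>j\<in>{1..N}. j \<in> {..<i} \<longleftrightarrow> norm y \<le> r j)"
    proof eventually_elim
      case (elim y)
      have "norm y \<le> r j" if "1 \<le> j" "j < i" for j
      proof -
        have "r (i - 1) \<le> r j"
          using that i by (intro radii_le) auto
        then show ?thesis
          using elim(1) that i by (auto simp: layer_def split: if_splits)
      qed
      moreover have "\<not> norm y \<le> r j" if "i \<le> j" "j \<le> N" for j
        using elim(2) that i radii_le[of i j] by simp
      ultimately show ?case
        using elim(1) by (meson atLeastAtMost_iff lessThan_iff atMost_iff not_le)
    qed
  qed (use i in simp)
  have inner: "((\<lambda>y. \<sigma> y *\<^sub>R layered_field_deriv b c h y (sgn y)) \<longlongrightarrow>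
      (\<epsilon> i * profile {..i} (r i)) *\<^sub>R h (sgn x)) (at x within {y. norm y < r i})"
  proof (rule lim)
    have "\<forall>\<^sub>F y in at x within {y. norm y < r i}. norm y < r i"
      by (simp add: eventually_at_filter)
    with eventually_inner_layer[OF i]
    show "\<forall>\<^sub>F y in at x within {y. norm y < r i}. y \<in> layer N r i \<and>
        (\<forall>j\<in>{1..N}. j \<in> {..i} \<longleftrightarrow> norm y \<le> r j)"
    proof eventually_elim
      case (elim y)
      have "norm y \<le> r j" if "1 \<le> j" "j \<le> i" for j
        using elim(2) that i radii_le[of j i] by simp
      moreover have "\<not> norm y \<le> r j" if "i < j" "j \<le> N" for j
      proof -
        have "r j \<le> r (i + 1)"
          using that by (intro radii_le) auto
        then show ?thesis
          using elim(1) that i by (auto simp: layer_def split: if_splits)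
      qed
      ultimately show ?case
        using elim(1) by (meson atLeastAtMost_iff lessThan_iff atMost_iff not_le)
    qed
  qed (use i in simp)
  have "\<epsilon> (i - 1) * profile {..<i} (r i) = \<epsilon> i * profile {..i} (r i)"
  proof -
    define S where "S = (\<Sum>j\<in>{1..N} - {i}. interface_coupling i j * c j)"
    have split: "(\<Sum>j\<in>{1..N}. f j) = f i + (\<Sum>j\<in>{1..N} - {i}. f j)" for f :: "nat \<Rightarrow> real"
      using i by (intro sum.remove) auto
    have "profile {..<i} (r i) = b + (- 2 * c i + S)"
      unfolding profile_def split S_def using radii_pos[OF i(1,2)]
      by (intro arg_cong2[where f = "(+)"] refl sum.cong) (auto simp: interface_coupling_def)
    moreover have "profile {..i} (r i) = b + (c i + S)"
      unfolding profile_def split S_def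
      by (intro arg_cong2[where f = "(+)"] refl sum.cong) (auto simp: interface_coupling_def)
    moreover have "b + S = lam \<epsilon> i * c i"
      using eqn[of i] i by (simp add: S_def)
    moreover have "lam \<epsilon> i * (\<epsilon> (i - 1) - \<epsilon> i) = 2 * \<epsilon> (i - 1) + \<epsilon> i"
      using \<epsilon>_neq[OF i(1,2)] by (simp add: lam_def)
    moreover have "e * (b' + (- 2 * c' + s)) = e' * (b' + (c' + s))"
      if "b' + s = l * c'" "l * (e - e') = 2 * e + e'" for b' c' s l e e' :: real
    proof -
      have "b' = l * c' - s"
        using that(1) by simp
      then have "e * (b' + (- 2 * c' + s)) - e' * (b' + (c' + s)) = (l * (e - e') - (2 * e + e')) * c'"
        by (simp only:) (simp add: algebra_simps)
      then show ?thesis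
        using that(2) by simp
    qed
    ultimately show ?thesis
      by metis
  qed
  moreover have "{y :: real ^ 3. norm y \<noteq> norm x} = {y. norm y < r i} \<union> {y. norm y > r i}"
    using i(3) by auto
  ultimately have "((\<lambda>y. \<sigma> y *\<^sub>R layered_field_deriv b c h y (sgn y)) \<longlongrightarrow>
      (\<epsilon> i * profile {..i} (r i)) *\<^sub>R h (sgn x)) (at x within {y. norm y \<noteq> norm x})"
    using inner outer by (simp only: Lim_within_Un)
  then show "\<exists>L. ((\<lambda>y. \<sigma> y *\<^sub>R layered_field_deriv b c h y (sgn y)) \<longlongrightarrow> L)
      (at x within {y. norm y \<noteq> norm x})"
    by blast
qed

text \<open>A charge makes a kink, which the zero field does not have. Concretely, let \<open>m\<close> be the innermost
  charged interface. Between \<open>r m\<close> and the next larger radius \<open>s\<close>, every other charged interface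
  contributes a multiple of \<open>h\<close>, whereas the potential of interface \<open>m\<close> is a dipole there, so equality of the amplitudes at \<open>r m\<close> and at \<open>s\<close> forces the
  charge \<open>c m\<close> to vanish.\<close>

lemma layered_field_zero_imp_coefficients_zero:
  assumes zero: "\<And>y. layered_field 0 c (inner (axis 1 1)) y = 0" and "k \<in> {1..N}"
  shows "c k = 0"
proof (rule ccontr)
  assume "c k \<noteq> 0"
  have amplitude: "(\<Sum>j\<in>{1..N}. c j * (r j / max (r j) s) ^ 3) = 0" if "s > 0" for s
    using zero[of "s *\<^sub>R axis 1 1"] that
    by (simp add: layered_field_def sphere_potential_def inner_axis_axis flip: sum_distrib_right mult.assoc)
  define m where "m = Max {j \<in> {1..N}. c j \<noteq> 0}"
  have "finite {j \<in> {1..N}. c j \<noteq> 0}" "k \<in> {j \<in> {1..N}. c j \<noteq> 0}"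
    using \<open>c k \<noteq> 0\<close> \<open>k \<in> {1..N}\<close> by auto
  then have "m \<in> {j \<in> {1..N}. c j \<noteq> 0}" and above: "\<And>j. j \<in> {1..N} \<Longrightarrow> c j \<noteq> 0 \<Longrightarrow> j \<le> m"
    unfolding m_def by (metis (no_types, lifting) Max_in empty_iff, simp)
  then have m: "1 \<le> m" "m \<le> N" "c m \<noteq> 0"
    by auto
  \<comment> \<open>Beyond the outermost interface any larger radius serves, here twice the outermost one.\<close>
  define s where "s = (if m = 1 then 2 * r 1 else r (m - 1))"
  have s: "r m < s" "s > 0"
    using m radii_pos[of m] radii_pos[of "m - 1"] radii_less[of "m - 1" m] by (auto simp: s_def)
  have split: "(\<Sum>j\<in>{1..N}. f j) = f m + (\<Sum>j\<in>{1..N} - {m}. f j)" for f :: "nat \<Rightarrow> real"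
    using m by (intro sum.remove) auto
  have "(r j / max (r j) t) ^ 3 = 1" if "1 \<le> j" "j < m" "t \<in> {r m, s}" for j t
  proof -
    have "t \<le> r j"
      using that m radii_le[of j m] radii_le[of j "m - 1"] by (auto simp: s_def)
    then show ?thesis
      using radii_pos[of j] that m by (simp add: max_absorb1)
  qed
  then have "c j * (r j / max (r j) (r m)) ^ 3 = c j * (r j / max (r j) s) ^ 3"
    if "j \<in> {1..N} - {m}" for j
    using above[of j] that by (cases "c j = 0"; cases "j < m") auto
  then have "(\<Sum>j\<in>{1..N} - {m}. c j * (r j / max (r j) (r m)) ^ 3)
      = (\<Sum>j\<in>{1..N} - {m}. c j * (r j / max (r j) s) ^ 3)"
    by (rule sum.cong[OF refl])
  then have "c m * (r m / max (r m) (r m)) ^ 3 = c m * (r m / max (r m) s) ^ 3"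
    using amplitude[OF s(2)] amplitude[OF radii_pos[OF m(1,2)]] unfolding split by linarith
  then have "(r m / s) ^ 3 = 1"
    using m s radii_pos[OF m(1,2)] by (simp add: max_absorb2)
  then have "r m / s = 1"
    using power_eq_1_iff[of "r m / s" 3] radii_pos[OF m(1,2)] s(2) by simp
  then show False
    using s by simp
qed

section \<open>The linear system\<close>

lemma transpose_P_mat_mult:
  assumes "v \<in> carrier_vec N" "i \<in> {1..N}"
  shows "vec_index (transpose_mat (P_mat N r \<epsilon>) *\<^sub>v v) (i - 1)
    = lam \<epsilon> i * vec_index v (i - 1) - (\<Sum>j\<in>{1..N} - {i}. interface_coupling i j * vec_index v (j - 1))"
proof -
  have "vec_index (transpose_mat (P_mat N r \<epsilon>) *\<^sub>v v) (i - 1)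
      = (\<Sum>j\<in>{..<N}. P_mat N r \<epsilon> $$ (j, i - 1) * vec_index v j)"
    using assms by (auto simp: P_mat_def scalar_prod_def lessThan_atLeast0)
  also have "\<dots> = (\<Sum>j\<in>{1..N}. P_mat N r \<epsilon> $$ (j - 1, i - 1) * vec_index v (j - 1))"
    by (simp add: sum.atLeast1_atMost_eq)
  also have "\<dots> = P_mat N r \<epsilon> $$ (i - 1, i - 1) * vec_index v (i - 1)
      + (\<Sum>j\<in>{1..N} - {i}. P_mat N r \<epsilon> $$ (j - 1, i - 1) * vec_index v (j - 1))"
    using assms(2) by (intro sum.remove) auto
  also have "(\<Sum>j\<in>{1..N} - {i}. P_mat N r \<epsilon> $$ (j - 1, i - 1) * vec_index v (j - 1))
      = (\<Sum>j\<in>{1..N} - {i}. - (interface_coupling i j * vec_index v (j - 1)))"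
  proof (rule sum.cong[OF refl])
    fix j assume "j \<in> {1..N} - {i}"
    then obtain i' j' where "i = Suc i'" "j = Suc j'" "i' < N" "j' < N" "i' \<noteq> j'"
      using assms(2) by (cases i; cases j) auto
    then show "P_mat N r \<epsilon> $$ (j - 1, i - 1) * vec_index v (j - 1)
        = - (interface_coupling i j * vec_index v (j - 1))"
      by (auto simp: P_mat_def interface_coupling_def)
  qed
  also have "P_mat N r \<epsilon> $$ (i - 1, i - 1) = lam \<epsilon> i"
    using assms(2) by (cases i) (auto simp: P_mat_def)
  finally show ?thesis
    by (simp add: sum_negf)
qed

end

text \<open>Degree one homogeneity cancels the normalisation \<open>x / |x|\<close>; at the origin both sides vanish.\<close>

lemma bounded_linear_background: "bounded_linear (background a)"
proof -
  have lin: "linear (Y1 m)" for m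
    by (rule linearI) (auto simp: Y1_def complex_eq_iff algebra_simps)
  have "background a = (\<lambda>x. \<Sum>m\<in>{-1..1}. a m * Y1 m x)"
  proof
    fix x
    have "complex_of_real (norm x) * (a m * Y1 m (x /\<^sub>R norm x)) = a m * Y1 m x" for m
      using linear_scale[OF lin, of m "norm x" "x /\<^sub>R norm x"] linear_0[OF lin, of m]
      by (cases "x = 0") (auto simp: scaleR_conv_of_real[where 'a = complex] simp flip: mult.assoc)
    then show "background a x = (\<Sum>m\<in>{-1..1}. a m * Y1 m x)"
      by (simp only: background_def sum_distrib_left)
  qed
  moreover have "bounded_linear (\<lambda>x. \<Sum>m\<in>{-1..1}. a m * Y1 m x)"
    by (intro bounded_linear_sum bounded_linear_const_mult)
       (use lin in \<open>simp add: linear_conv_bounded_linear\<close>)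
  ultimately show ?thesis
    by simp
qed

theorem theorem2p1:
  fixes N :: nat and r \<epsilon> :: "nat \<Rightarrow> real" and \<sigma> :: "real ^ 3 \<Rightarrow> real"
    and a :: "int \<Rightarrow> complex" and H u :: "real ^ 3 \<Rightarrow> complex"
  assumes "N \<ge> 1"
    and "\<And>j. 1 \<le> j \<Longrightarrow> j < N \<Longrightarrow> r j > r (j + 1)"
    and "r N > 0"
    and "\<And>j. j \<le> N \<Longrightarrow> \<epsilon> j > 0"
    and "\<And>j. 1 \<le> j \<Longrightarrow> j \<le> N \<Longrightarrow> \<epsilon> (j - 1) \<noteq> \<epsilon> j"
    and "\<And>j x. j \<le> N \<Longrightarrow> x \<in> layer N r j \<Longrightarrow> \<sigma> x = \<epsilon> j"
    and "H = background a"
    and "layered_solution N r \<sigma> u"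
    and "(\<lambda>x. norm (u x - H x)) \<in> O[at_infinity](\<lambda>x. 1 / norm x)"
  shows "\<exists>Q. Q \<in> carrier_mat N N \<and>
           inverts_mat (transpose_mat (P_mat N r \<epsilon>)) Q \<and>
           inverts_mat Q (transpose_mat (P_mat N r \<epsilon>)) \<and>
           (\<forall>x\<in>layer N r 0.
              u x - H x =
                complex_of_real (1 / norm x ^ 3) * H x *
                complex_of_real
                  (scalar_prod (ones_vec N) (Upsilon_mat N r *\<^sub>v (Q *\<^sub>v ones_vec N))))"
proof -
  interpret layers N r
    by unfold_locales (use assms(1-3) in auto)
  define A where "A = transpose_mat (P_mat N r \<epsilon>)"
  have A: "A \<in> carrier_mat N N"
    by (simp add: A_def P_mat_def)
  have "\<exists>m>0. \<forall>x. \<sigma> x \<ge> m"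
    by (rule coefficient_bounded_below[where \<epsilon> = \<epsilon>]) (use assms(4,6) in blast)+
  then obtain m where "m > 0" and \<sigma>_ge: "\<And>x. \<sigma> x \<ge> m"
    by blast
  have radii: "finite radii" "\<And>\<rho>. \<rho> \<in> radii \<Longrightarrow> \<rho> > 0"
    by (auto simp: radii_def radii_pos)

  \<comment> \<open>A kernel vector of the matrix would be a system of charges that generates a decaying field
     without any background. By uniqueness this field is zero, hence so are the charges.
     Any nonzero linear function can generate the potentials, here the first coordinate.\<close>
  have "Determinant.det A \<noteq> 0"
  proof
    assume "Determinant.det A = 0"
    then obtain v where v: "v \<in> carrier_vec N" "v \<noteq> 0\<^sub>v N" "A *\<^sub>v v = 0\<^sub>v N"
      using det_0_iff_vec_prod_zero[OF A] by blast
    define c where "c j = vec_index v (j - 1)" for j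
    let ?h = "inner (axis 1 1) :: real ^ 3 \<Rightarrow> real"
    have h: "bounded_linear ?h"
      by (rule bounded_linear_inner_right)
    have eqn: "lam \<epsilon> i * c i - (\<Sum>j\<in>{1..N} - {i}. interface_coupling i j * c j) = 0" if "i \<in> {1..N}" for i
      using transpose_P_mat_mult[OF v(1) that, of \<epsilon>] v(3) that by (auto simp: A_def c_def)
    have sol: "transmission_solution radii \<sigma> (layered_field 0 c ?h) (layered_field_deriv 0 c ?h)"
      by (rule layered_field_transmission_solution[OF h, where \<epsilon> = \<epsilon>]) (use assms(5,6) eqn in blast)+
    have "layered_field 0 c ?h y = 0" for y
      using transmission_solution_unique[OF radii \<open>m > 0\<close> \<sigma>_ge sol]
        layered_field_diff_tendsto_0[OF h, of 0 c] by simp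
    then have "c k = 0" if "k \<in> {1..N}" for k
      using layered_field_zero_imp_coefficients_zero that by blast
    then have "vec_index v k = 0" if "k < N" for k
      using that by (force simp: c_def dest: spec[of _ "Suc k"])
    then have "v = 0\<^sub>v N"
      using v(1) by (intro eq_vecI) auto
    with v(2) show False ..
  qed
  from det_non_zero_imp_unit[OF A this, of "()"]
  obtain Q where Q: "Q \<in> carrier_mat N N" "A * Q = 1\<^sub>m N" "Q * A = 1\<^sub>m N"
    by (auto simp: Units_def ring_mat_simps)

  \<comment> \<open>The charges that compensate the background \<open>H\<close>; the resulting field and \<open>u\<close> solve the same
     transmission problem.\<close>
  define v where "v = Q *\<^sub>v ones_vec N"
  define c where "c j = vec_index v (j - 1)" for j
  have v: "v \<in> carrier_vec N"
    using Q(1) by (simp add: v_def ones_vec_def)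
  have "A *\<^sub>v v = ones_vec N"
    unfolding v_def using Q A by (simp add: ones_vec_def flip: assoc_mult_mat_vec)
  then have eqn: "lam \<epsilon> i * c i - (\<Sum>j\<in>{1..N} - {i}. interface_coupling i j * c j) = 1" if "i \<in> {1..N}" for i
    using transpose_P_mat_mult[OF v that, of \<epsilon>] that by (auto simp: A_def c_def ones_vec_def)
  have H: "bounded_linear H"
    by (simp add: assms(7) bounded_linear_background)
  have "u x = layered_field 1 c H x" for x
  proof -
    have "transmission_solution radii \<sigma> (layered_field 1 c H) (layered_field_deriv 1 c H)"
      by (rule layered_field_transmission_solution[OF H, where \<epsilon> = \<epsilon>]) (use assms(5,6) eqn in blast)+
    from transmission_solution_diff[OF layered_solution_imp_transmission_solution[OF assms(8)] this]
    have sol: "transmission_solution radii \<sigma> (\<lambda>y. u y - layered_field 1 c H y)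
        (\<lambda>y v. frechet_derivative u (at y) v - layered_field_deriv 1 c H y v)" .
    have "((\<lambda>y. u y - H y) \<longlongrightarrow> 0) at_infinity"
    proof -
      obtain K where "\<forall>\<^sub>F y in at_infinity. norm (u y - H y) \<le> K * (1 / norm y)"
        using landau_o.bigE[OF assms(9)] by auto
      moreover have "((\<lambda>y :: real ^ 3. K * (1 / norm y)) \<longlongrightarrow> 0) at_infinity"
        using tendsto_mult[OF tendsto_const[of K] tendsto_inverse_0_at_top[OF filterlim_norm_at_top]]
        by (simp add: divide_inverse)
      ultimately show ?thesis
        by (rule Lim_null_comparison)
    qed
    from tendsto_diff[OF this layered_field_diff_tendsto_0[OF H, of 1 c]]
    have "((\<lambda>y. u y - layered_field 1 c H y) \<longlongrightarrow> 0) at_infinity"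
      by simp
    from transmission_solution_unique[OF radii \<open>m > 0\<close> \<sigma>_ge sol this, of x]
    show ?thesis
      by simp
  qed
  moreover have "scalar_prod (ones_vec N) (Upsilon_mat N r *\<^sub>v v) = (\<Sum>j\<in>{1..N}. c j * r j ^ 3)"
  proof -
    have "vec_index (Upsilon_mat N r *\<^sub>v v) j = c (Suc j) * r (Suc j) ^ 3" if "j < N" for j
      using that v by (simp add: Upsilon_mat_def mat_diag_def scalar_prod_def c_def if_distrib[of "\<lambda>z. z * _"] cong: if_cong)
    moreover have "dim_vec (Upsilon_mat N r *\<^sub>v v) = N"
      by (simp add: Upsilon_mat_def mat_diag_def)
    ultimately have "scalar_prod (ones_vec N) (Upsilon_mat N r *\<^sub>v v) = (\<Sum>j\<in>{0..<N}. c (Suc j) * r (Suc j) ^ 3)"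
      unfolding scalar_prod_def by (intro sum.cong) (auto simp: ones_vec_def)
    then show ?thesis
      by (simp add: sum.atLeast1_atMost_eq lessThan_atLeast0)
  qed
  ultimately have "u x - H x = complex_of_real (1 / norm x ^ 3) * H x *
      complex_of_real (scalar_prod (ones_vec N) (Upsilon_mat N r *\<^sub>v (Q *\<^sub>v ones_vec N)))"
    if "x \<in> layer N r 0" for x
    using that layered_field_outside[of x 1 c H]
    by (simp add: layer_def scaleR_conv_of_real inverse_eq_divide power_one_over flip: v_def)
  then show ?thesis
    using Q A unfolding A_def[symmetric] by (intro exI[of _ Q]) (auto simp: inverts_mat_def)
qed

end
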